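(* For every positive integer $d$, the following hold (MISs, the operators $f,f',g,g'$ and the action of $\mathbb{S}_d$ are as defined in the context). (1) Every $\mathbb{S}_d$-orbit of MISs of $B(d,3)$ is obtained from either the orbit of $\{000\}$ (the MIS of $B(1,3)$) or the $\mathbb{S}_2$-orbit of the MIS $\{000,010,111\}$ of $B(2,3)$ by a unique (possibly empty) finite sequence of applications of $f,f',g,g'$. That is, for every orbit there is exactly one pair consisting of one of these two starting orbits and a finite sequence of operators from $\{f,f',g,g'\}$ such that applying the operators successively to the starting orbit yields the given orbit. (2) If $S$ is an MIS of $B(d,3)$, then the subgroup of $\mathbb{S}_d$ stabilizing $S$ is generated by (pairwise) disjoint transpositions. In particular, the cardinality of the stabilizer of $S$ is a power of $2$. (3) Let $b_{d,k}$ ($d\ge 1$, $k\ge 0$) be the number of $\mathbb{S}_d$-orbits of MISs of $B(d,3)$ whose elements have stabilizers of size $2^k$, with the convention $b_{d,-1}=0$. Then $b_{1,0}=1$, $b_{2,0}=3$, and $$b_{d,k}=2b_{d-1,k}+2b_{d-2,k-1}\qquad\text{for } d\ge 3,\ k\ge 0,$$ and, as formal power series, $$\sum_{d=1}^\infty\sum_{k=0}^\infty b_{d,k}t^ds^k=\frac{t+t^2}{1-2t-2t^2s}.$$ (4) The number $a_d$ of MISs of $B(d,3)$ satisfies $a_1=1$, $a_2=6$, and $$a_d=2d\,a_{d-1}+d(d-1)\,a_{d-2}\qquad\text{for } d\ge 3,$$ and has exponential generating function $$\sum_{d=1}^\infty\frac{a_dt^d}{d!}=\frac{t+t^2}{1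-2t-t^2}.$$
   Context: For a positive integer $d$ let $[d]=\{0,\dots,d-1\}$. The de Bruijn graph $B(d,3)$ is the directed graph whose nodes are the words $xyz$ with $x,y,z\in[d]$, with an edge from $x_1x_2x_3$ to $y_1y_2y_3$ if and only if $x_2x_3=y_1y_2$. An independent set is a set of nodes containing no edge. An MIS of $B(d,3)$ is an independent set of maximum cardinality of the graph obtained from $B(d,3)$ by deleting the self-edges $xxx\to xxx$, $x\in[d]$. For a set $S$ of nodes, $L(S)=\{x\in[d] : xxx\in S\}$ is the set of loops of $S$. It is known that every MIS $S$ of $B(d,3)$ has $\frac{d^3-d}{3}+1$ elements and one or two loops, and that there is exactly one loop $a\in L(S)$ (the distinguished loop) such that $aya\in S$ for all $y\in[d]$. If $S$ has a second loop, it is denoted $b$. For a node $w$, $w[x\to y]$ is the node obtained by replacing every occurrence of the digit $x$ in $w$ by $y$; $x\in w$ means that $x$ is one of the digits of $w$. For an MIS $S$ of $B(d,3)$, define $f(S)$ and $f'(S)$ (subsets of the nodes of $B(d+1,3)$) by $f(S)=S\cup U_1\cup U_2\cup U_3\cup U_4\cup U_5$ and $f'(S)=S\cup U_1\cup U_2\cup U_3\cup U_4\cup U_5'$, where - $U_1=\{w[a\to d] : w\in S,\ a\in w,\ w\ne aaa,\ w\ne aba\}$ (the condition $w\neq aba$ only applies if $b$ exists), - $U_2=\{axd : x\in[d]\setminus L(S)\}$, $U_3=\{dxa : x\in[d]\setminus L(S)\}$, - $U_4=\{udv : u,v\in L(S)\}$, $U_5=\{udd : u\in L(S)\}$, $U_5'=\{ddu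 : u\in L(S)\}$. Define $g(S)$ and $g'(S)$ (subsets of the nodes of $B(d+2,3)$) by $g(S)=S\cup V_1\cup\dots\cup V_8$ and $g'(S)=S\cup V_1\cup\dots\cup V_5\cup V_6'\cup V_7'\cup V_8'$, where, with $Y=\{d,d+1\}$, - $V_1=\{w[a\to y] : y\in Y,\ w\in S,\ a\in w,\ w\neq aaa,\ w\ne aba\}$, - $V_2=\{axy : x\in[d]\setminus L(S),\ y\in Y\}$, $V_3=\{yxa : x\in[d]\setminus L(S),\ y\in Y\}$, - $V_4=\{yxz : y,z\in Y,\ y\ne z,\ x\in[d]\setminus L(S)\}$, $V_5=\{uyv : u,v\in L(S),\ y\in Y\}$, - $V_6=\{uyy : u\in L(S),\ y\in Y\}$, $V_7=\{yzu : y,z\in Y,\ y\ne z,\ u\in L(S)\}$, $V_8=\{d(d+1)(d+1),\ (d+1)dd\}$, - $V_6'=\{yyu : u\in L(S),\ y\in Y\}$, $V_7'=\{uyz : y,z\in Y,\ y\neq z,\ u\in L(S)\}$, $V_8'=\{(d+1)(d+1)d,\ dd(d+1)\}$. The symmetric group $\mathbb{S}_d$ of permutations of $[d]$ acts on nodes by $\sigma(xyz)=\sigma(x)\sigma(y)\sigma(z)$, hence on sets of nodes; it permutes the MISs. The operators $f,f'$ send MISs of $B(d,3)$ to MISs of $B(d+1,3)$, and $g,g'$ send them to MISs of $B(d+2,3)$; each is compatible with the group actions and so sends $\mathbb{S}_d$-orbits of MISs to orbits of MISs under $\mathbb{S}_{d+1}$ or $\mathbb{S}_{d+2}$. *)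

theory Defs
  imports
    "HOL-Algebra.Group_Action"
    "HOL-Algebra.Generated_Groups"
    "HOL-Combinatorics.Permutations"
    "HOL-Computational_Algebra.Formal_Power_Series"
begin

type_synonym node = "nat \<times> nat \<times> nat"

text \<open>The digit set $[d]$ is rendered as \<^term>\<open>{..<d}\<close>, and the word $xyz$ as \<^term>\<open>(x, y, z)\<close>.\<close>

definition nodes :: "nat \<Rightarrow> node set" where
  "nodes d = {..<d} \<times> {..<d} \<times> {..<d}"

definition de_bruijn :: "nat \<Rightarrow> node rel" where
  "de_bruijn d = {((x1, x2, x3), (y1, y2, y3)) | x1 x2 x3 y1 y2 y3.
     (x1, x2, x3) \<in> nodes d \<and> (y1, y2, y3) \<in> nodes d \<and> x2 = y1 \<and> x3 = y2}"

definition self_edges :: "nat \<Rightarrow> node rel" where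
  "self_edges d = {((x, x, x), (x, x, x)) | x. x < d}"

definition independent_in :: "'a set \<Rightarrow> 'a rel \<Rightarrow> 'a set \<Rightarrow> bool" where
  "independent_in V E S \<longleftrightarrow> S \<subseteq> V \<and> E \<inter> S \<times> S = {}"

definition MIS :: "nat \<Rightarrow> node set set" where
  "MIS d = {S. independent_in (nodes d) (de_bruijn d - self_edges d) S \<and>
     (\<forall>T. independent_in (nodes d) (de_bruijn d - self_edges d) T \<longrightarrow> card T \<le> card S)}"


definition loops :: "node set \<Rightarrow> nat set" where
  "loops S = {x. (x, x, x) \<in> S}"

text \<open>For \<^term>\<open>S \<in> MIS d\<close> there is exactly one such loop; otherwise the value is irrelevant.\<close>

definition dist_loop :: "nat \<Rightarrow> node set \<Rightarrow> nat" where
  "dist_loop d S = (THE a. a \<in> loops S \<and> (\<forall>y<d. (a, y, a) \<in> S))"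

fun digits :: "node \<Rightarrow> nat set" where
  "digits (x, y, z) = {x, y, z}"

fun map_node :: "(nat \<Rightarrow> nat) \<Rightarrow> node \<Rightarrow> node" where
  "map_node h (x, y, z) = (h x, h y, h z)"

definition replace_digit :: "nat \<Rightarrow> nat \<Rightarrow> node \<Rightarrow> node" where
  "replace_digit x y w = map_node (\<lambda>z. if z = x then y else z) w"

text \<open>
  The words in which the distinguished loop $a$ is to be replaced by a new digit. The set
  \<^term>\<open>loops S - {a}\<close> is $\{b\}$ if the second loop $b$ exists and empty otherwise, so the condition
  $w \neq aba$ is imposed exactly when $b$ exists.
\<close>

definition replaceable :: "nat \<Rightarrow> node set \<Rightarrow> node set" where
  "replaceable d S = (let a = dist_loop d S in
     {w \<in> S. a \<in> digits w \<and> w \<noteq> (a, a, a) \<and> (\<forall>b \<in> loops S - {a}. w \<noteq> (a, b, a))})"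


text \<open>
  The argument \<^term>\<open>d\<close> of the operators is the alphabet size of the input; the new digits are $d$
  (and $d+1$). The common parts $S \cup U_1 \cup \dots \cup U_4$ of $f, f'$ and
  $S \cup V_1 \cup \dots \cup V_5$ of $g, g'$ are split off.
\<close>

definition f_base :: "nat \<Rightarrow> node set \<Rightarrow> node set" where
  "f_base d S = (let a = dist_loop d S; L = loops S in
     S
     \<union> {replace_digit a d w | w. w \<in> replaceable d S}
     \<union> {(a, x, d) | x. x \<in> {..<d} - L}
     \<union> {(d, x, a) | x. x \<in> {..<d} - L}
     \<union> {(u, d, v) | u v. u \<in> L \<and> v \<in> L})"

definition op_f :: "nat \<Rightarrow> node set \<Rightarrow> node set" where
  "op_f d S = f_base d S \<union> {(u, d, d) | u. u \<in> loops S}"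

definition op_f' :: "nat \<Rightarrow> node set \<Rightarrow> node set" where
  "op_f' d S = f_base d S \<union> {(d, d, u) | u. u \<in> loops S}"

definition g_base :: "nat \<Rightarrow> node set \<Rightarrow> node set" where
  "g_base d S = (let a = dist_loop d S; L = loops S; Y = {d, d + 1} in
     S
     \<union> {replace_digit a y w | y w. y \<in> Y \<and> w \<in> replaceable d S}
     \<union> {(a, x, y) | x y. x \<in> {..<d} - L \<and> y \<in> Y}
     \<union> {(y, x, a) | x y. x \<in> {..<d} - L \<and> y \<in> Y}
     \<union> {(y, x, z) | x y z. y \<in> Y \<and> z \<in> Y \<and> y \<noteq> z \<and> x \<in> {..<d} - L}
     \<union> {(u, y, v) | u v y. u \<in> L \<and> v \<in> L \<and> y \<in> Y})"

definition op_g :: "nat \<Rightarrow> node set \<Rightarrow> node set" where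
  "op_g d S = (let L = loops S; Y = {d, d + 1} in
     g_base d S
     \<union> {(u, y, y) | u y. u \<in> L \<and> y \<in> Y}
     \<union> {(y, z, u) | u y z. y \<in> Y \<and> z \<in> Y \<and> y \<noteq> z \<and> u \<in> L}
     \<union> {(d, d + 1, d + 1), (d + 1, d, d)})"

definition op_g' :: "nat \<Rightarrow> node set \<Rightarrow> node set" where
  "op_g' d S = (let L = loops S; Y = {d, d + 1} in
     g_base d S
     \<union> {(y, y, u) | u y. u \<in> L \<and> y \<in> Y}
     \<union> {(u, y, z) | u y z. y \<in> Y \<and> z \<in> Y \<and> y \<noteq> z \<and> u \<in> L}
     \<union> {(d + 1, d + 1, d), (d, d, d + 1)})"


text \<open>The symmetric group on $\{0,\dots,d-1\}$ (the library's \<open>sym_group\<close> acts on $\{1,\dots,d\}$).\<close>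

definition perm_group :: "nat \<Rightarrow> (nat \<Rightarrow> nat) monoid" where
  "perm_group d = \<lparr> carrier = {p. p permutes {..<d}}, monoid.mult = (\<circ>), one = id \<rparr>"

definition act :: "(nat \<Rightarrow> nat) \<Rightarrow> node set \<Rightarrow> node set" where
  "act p S = map_node p ` S"

definition MIS_orbits :: "nat \<Rightarrow> node set set set" where
  "MIS_orbits d = orbits (perm_group d) (MIS d) act"

definition stab :: "nat \<Rightarrow> node set \<Rightarrow> (nat \<Rightarrow> nat) set" where
  "stab d S = stabilizer (perm_group d) act S"

definition transpositions :: "nat \<Rightarrow> (nat \<Rightarrow> nat) set" where
  "transpositions d = {transpose i j | i j. i < d \<and> j < d \<and> i \<noteq> j}"

definition disjoint_perms :: "('a \<Rightarrow> 'a) \<Rightarrow> ('a \<Rightarrow> 'a) \<Rightarrow> bool" where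
  "disjoint_perms p q \<longleftrightarrow> {x. p x \<noteq> x} \<inter> {x. q x \<noteq> x} = {}"


text \<open>
  Operator names, so that sequences of operators are formal words. A pair \<^term>\<open>(d, C)\<close> below is a
  set \<^term>\<open>C\<close> of sets of nodes of $B(d,3)$. An operator sends the orbit of \<^term>\<open>S\<close> to the orbit of
  the image of \<^term>\<open>S\<close>; the union over all representatives \<^term>\<open>S \<in> C\<close> is that orbit because the
  operators are compatible with the group actions.
\<close>

datatype oper = Op_f | Op_f' | Op_g | Op_g'

fun oper_incr :: "oper \<Rightarrow> nat" where
  "oper_incr Op_f = 1"
| "oper_incr Op_f' = 1"
| "oper_incr Op_g = 2"
| "oper_incr Op_g' = 2"

fun oper_fun :: "oper \<Rightarrow> nat \<Rightarrow> node set \<Rightarrow> node set" where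
  "oper_fun Op_f = op_f"
| "oper_fun Op_f' = op_f'"
| "oper_fun Op_g = op_g"
| "oper_fun Op_g' = op_g'"

fun apply_oper :: "oper \<Rightarrow> nat \<times> node set set \<Rightarrow> nat \<times> node set set" where
  "apply_oper F (d, C) =
     (d + oper_incr F, \<Union>S\<in>C. orbit (perm_group (d + oper_incr F)) act (oper_fun F d S))"

definition start_orbits :: "(nat \<times> node set set) set" where
  "start_orbits =
     {(1, orbit (perm_group 1) act {(0, 0, 0)}),
      (2, orbit (perm_group 2) act {(0, 0, 0), (0, 1, 0), (1, 1, 1)})}"


definition num_MIS :: "nat \<Rightarrow> nat" where
  "num_MIS d = card (MIS d)"

text \<open>The second index is an integer to accommodate the convention $b_{d,-1} = 0$.\<close>

definition num_orbits :: "nat \<Rightarrow> int \<Rightarrow> nat" where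
  "num_orbits d k = (if k < 0 then 0
     else card {C \<in> MIS_orbits d. \<forall>S\<in>C. card (stab d S) = 2 ^ nat k})"

text \<open>
  Power series in $t$ and $s$ are power series in $t$ whose coefficients are power series in $s$.
  Both generating functions start at $d = 1$.
\<close>

definition var_t :: "rat fps fps" where "var_t = fps_X"

definition var_s :: "rat fps fps" where "var_s = fps_const fps_X"

definition orbit_gf :: "rat fps fps" where
  "orbit_gf = Abs_fps (\<lambda>d. if d = 0 then 0 else Abs_fps (\<lambda>k. of_nat (num_orbits d (int k))))"

definition MIS_egf :: "rat fps" where
  "MIS_egf = Abs_fps (\<lambda>d. if d = 0 then 0 else of_nat (num_MIS d) / fact d)"

end

theory Submission
  imports Defs
begin

text \<open>
  If the digits of \<open>xyz\<close> are not all equal, then \<open>xyz\<close>, \<open>yzx\<close>, \<open>zxy\<close> form a directed triangle, so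
  an independent set \<open>S\<close> contains at most one word of each of these \<open>(d\<^sup>3 - d) / 3\<close> rotation
  classes. Loops are additional elements, but each pair of loops \<open>l\<close>, \<open>m\<close> of \<open>S\<close> costs one of the
  classes of \<open>llm\<close> and \<open>mml\<close>. With \<open>k\<close> loops the net gain is at most \<open>k - k (k - 1) / 2 \<le> 1\<close>.
  So a maximum independent set has one or two loops and misses no class that it is not forced to
  miss (lemmas \<open>card_missed_ge\<close>, \<open>indep_card_le\<close>, \<open>MIS_loops\<close>).

  This rigidity determines \<open>S\<close>. Independence says that a pair of digits cannot both start a word
  of \<open>S\<close> and end another one, except for the loops. Write \<open>E x y\<close>, read ``\<open>x\<close> beats \<open>y\<close>'', if \<open>xy\<close>
  starts a word of \<open>S\<close>. Then \<open>S\<close> consists of its loops and of all words \<open>xyz\<close> with \<open>E x y\<close> and not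
  \<open>E y z\<close>, loop pairs excluded (theorem \<open>MIS_is_dicut\<close>). The distinguished loop beats all other
  digits and the second loop all but the distinguished one, and on the remaining digits the only
  condition is that no rotation class is missed, that is, that \<open>E x y\<close>, \<open>E y z\<close>, \<open>E z x\<close> are not
  all equal unless \<open>x = y = z\<close>. For three different digits this is transitivity, and for \<open>xxy\<close> it
  forbids most ties. As a result, the remaining digits are arranged in a linear order of blocks of
  size one or two, and each block carries one free bit, namely whether its digits beat themselves.

  The four operators put one more block on top of this order, just below the loops: \<open>f\<close> and \<open>f'\<close> a
  block of one digit, \<open>g\<close> and \<open>g'\<close> a block of two, and the prime records the bit (lemma
  \<open>oper_fun_dicut\<close>). The top block is visible in \<open>S\<close> itself, as the set of non-loop digits that no
  other non-loop digit strictly beats. Hence, up to permuting the digits, every maximum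
  independent set with a non-loop digit arises by an operator, and the operator and the orbit to
  which it was applied are unique (theorems \<open>MIS_decompose\<close>, \<open>oper_fun_unique\<close>). The sets without
  non-loop digits make up the two starting orbits. This proves the first claim.

  A permutation stabilizing \<open>S\<close> respects the blocks and their order, so it can only exchange the
  digits of blocks of size two, and these exchanges do stabilize \<open>S\<close>; this is the second claim. In
  particular \<open>f\<close>, \<open>f'\<close> keep the size of the stabilizer and \<open>g\<close>, \<open>g'\<close> double it. A sum over orbits
  of any function of this size therefore satisfies a recurrence (lemma \<open>orbit_sum_rec\<close>), which
  yields the remaining claims: the function is an indicator function for
  \<open>b\<^sub>d\<^sub>,\<^sub>k\<close>, and by the orbit-stabilizer theorem it is the reciprocal for
  \<open>a\<^sub>d / d!\<close>.
\<close>

section \<open>Counting rotation classes\<close>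

abbreviation indep :: "nat \<Rightarrow> node set \<Rightarrow> bool" where
  "indep d S \<equiv> independent_in (nodes d) (de_bruijn d - self_edges d) S"

lemma indep_iff:
  "indep d S \<longleftrightarrow> S \<subseteq> nodes d \<and>
     (\<forall>x y z w. (x, y, z) \<in> S \<longrightarrow> (y, z, w) \<in> S \<longrightarrow> x = y \<and> y = z \<and> z = w)"
proof (cases "S \<subseteq> nodes d")
  case sub: True
  show ?thesis
  proof
    assume S: "indep d S"
    have "x = y \<and> y = z \<and> z = w" if "(x, y, z) \<in> S" "(y, z, w) \<in> S" for x y z w
    proof -
      have "((x, y, z), (y, z, w)) \<in> de_bruijn d"
        unfolding de_bruijn_def using that sub by blast
      moreover have "((x, y, z), (y, z, w)) \<notin> de_bruijn d - self_edges d"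
        using S that unfolding independent_in_def by blast
      ultimately show ?thesis
        unfolding self_edges_def by auto
    qed
    then show "S \<subseteq> nodes d \<and> (\<forall>x y z w. (x, y, z) \<in> S \<longrightarrow> (y, z, w) \<in> S \<longrightarrow> x = y \<and> y = z \<and> z = w)"
      using sub by blast
  next
    assume *: "S \<subseteq> nodes d \<and> (\<forall>x y z w. (x, y, z) \<in> S \<longrightarrow> (y, z, w) \<in> S \<longrightarrow> x = y \<and> y = z \<and> z = w)"
    have "e \<in> self_edges d" if "e \<in> de_bruijn d" "e \<in> S \<times> S" for e
    proof -
      obtain x y z w where e: "e = ((x, y, z), (y, z, w))" "(x, y, z) \<in> nodes d"
        using \<open>e \<in> de_bruijn d\<close> unfolding de_bruijn_def by blast
      then have "x = y \<and> y = z \<and> z = w" using * \<open>e \<in> S \<times> S\<close> by blast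
      then show ?thesis using e unfolding self_edges_def nodes_def by simp
    qed
    then show "indep d S" using sub unfolding independent_in_def by blast
  qed
qed (auto simp: independent_in_def)

lemma indep_subset: "indep d S \<Longrightarrow> S \<subseteq> nodes d"
  by (simp add: independent_in_def)

lemma indepD:
  assumes "indep d S" "(x, y, z) \<in> S" "(y, z, w) \<in> S"
  shows "x = y \<and> y = z \<and> z = w"
  using iffD1[OF indep_iff assms(1), THEN conjunct2, rule_format, OF assms(2,3)] .

fun rot :: "node \<Rightarrow> node" where
  "rot (x, y, z) = (y, z, x)"

definition diag :: "node set" where
  "diag = {(x, x, x) | x. True}"

text \<open>
  The words whose rotation classes avoid \<open>S\<close>. Only words with at least two different digits count:
  their three rotations are distinct and form a directed triangle.
\<close>

definition missed :: "nat \<Rightarrow> node set \<Rightarrow> node set" where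
  "missed d S = {w \<in> nodes d - diag. w \<notin> S \<and> rot w \<notin> S \<and> rot (rot w) \<notin> S}"

lemma finite_nodes: "finite (nodes d)"
  by (simp add: nodes_def)

lemma finite_indep: "indep d S \<Longrightarrow> finite S"
  using indep_subset finite_nodes finite_subset by blast

lemma finite_missed: "finite (missed d S)"
  unfolding missed_def using finite_nodes by auto

lemma inj_rot: "inj_on rot A"
  by (rule inj_onI) (auto elim!: rot.elims)

lemma rot3: "rot (rot (rot w)) = w"
  by (cases w) simp

lemma rot_nondiag: "rot w \<in> nodes d - diag \<longleftrightarrow> w \<in> nodes d - diag"
  by (cases w) (auto simp: nodes_def diag_def)

lemma in_rot_image: "w \<in> rot ` A \<longleftrightarrow> rot (rot w) \<in> A" "w \<in> rot ` rot ` A \<longleftrightarrow> rot w \<in> A"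
proof -
  show 1: "w \<in> rot ` A \<longleftrightarrow> rot (rot w) \<in> A" for w A
    by (rule iffI, elim imageE, simp add: rot3, rule image_eqI[where x = "rot (rot w)"], simp_all add: rot3)
  show "w \<in> rot ` rot ` A \<longleftrightarrow> rot w \<in> A"
    by (simp add: 1 rot3)
qed

text \<open>
  Each word is adjacent to its rotation, so a rotation class of three words contains at most one
  element of an independent set.
\<close>

lemma rot_indep:
  assumes "indep d S" "w \<in> S - diag"
  shows "rot w \<notin> S"
  using assms indepD[OF assms(1)] by (cases w) (auto simp: diag_def)

lemma card_loops:
  assumes "indep d S"
  shows "card S = card (S - diag) + card (loops S)" "finite (loops S)" "loops S \<subseteq> {..<d}"
proof -
  have im: "S \<inter> diag = (\<lambda>x. (x, x, x)) ` loops S"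
    by (auto simp: loops_def diag_def)
  have c: "card (S \<inter> diag) = card (loops S)"
    unfolding im by (rule card_image) (auto simp: inj_on_def)
  show "card S = card (S - diag) + card (loops S)"
    using card_Int_Diff[of S diag] finite_indep[OF assms] c by simp
  show "loops S \<subseteq> {..<d}"
    using indep_subset[OF assms] by (auto simp: loops_def nodes_def)
  then show "finite (loops S)"
    using finite_subset by blast
qed

text \<open>
  The words with at least two different digits split into the three pairwise disjoint rotates of
  the non-loops of \<open>S\<close> and the missed words.
\<close>

lemma card_missed:
  assumes S: "indep d S"
  shows "3 * card (S - diag) + card (missed d S) + d = d ^ 3"
proof -
  let ?A = "S - diag" and ?N = "nodes d - diag"
  have fin: "finite ?A" using finite_indep[OF S] by simp
  have sub: "S \<subseteq> nodes d" using indep_subset[OF S] .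
  have N: "?N = ?A \<union> rot ` ?A \<union> rot ` rot ` ?A \<union> missed d S"
  proof (rule Set.set_eqI, goal_cases)
    case (1 w) show "w \<in> ?N \<longleftrightarrow> w \<in> ?A \<union> rot ` ?A \<union> rot ` rot ` ?A \<union> missed d S"
      using sub rot_nondiag[of w d] rot_nondiag[of "rot w" d] unfolding Un_iff in_rot_image missed_def by (auto simp: rot3)
  qed
  have R: "v \<in> ?A \<Longrightarrow> rot v \<notin> ?A" for v
    using rot_indep[OF S] by blast
  have d1: "?A \<inter> rot ` ?A = {}"
    unfolding disjoint_iff in_rot_image using R rot3 by metis
  have d2: "(?A \<union> rot ` ?A) \<inter> rot ` rot ` ?A = {}"
    unfolding disjoint_iff in_rot_image Un_iff using R rot3 by metis
  have d3: "(?A \<union> rot ` ?A \<union> rot ` rot ` ?A) \<inter> missed d S = {}"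
    unfolding missed_def by (auto simp: in_rot_image rot3)
  have cN: "card ?N + d = d ^ 3"
  proof -
    have "nodes d \<inter> diag = (\<lambda>x. (x, x, x)) ` {..<d}"
      by (auto simp: nodes_def diag_def)
    then have "card (nodes d \<inter> diag) = d"
      by (simp add: card_image inj_on_def)
    moreover have "card (nodes d) = d ^ 3"
      by (simp add: nodes_def power3_eq_cube)
    ultimately show ?thesis
      using card_Int_Diff[OF finite_nodes, of d diag] by simp
  qed
  have "card ?N = card ?A + card (rot ` ?A) + card (rot ` rot ` ?A) + card (missed d S)"
    unfolding N using fin finite_missed[of d S] d1 d2 d3 by (simp add: card_Un_disjoint del: Un_iff)
  also have "\<dots> = 3 * card ?A + card (missed d S)"
    by (simp add: card_image inj_rot)
  finally show ?thesis using cN by simp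
qed

text \<open>
  Any two loops \<open>l\<close>, \<open>m\<close> of \<open>S\<close> cost one rotation class. The words \<open>llm\<close> and \<open>mll\<close> are adjacent to
  \<open>lll\<close>, so the class of \<open>llm\<close> can be hit in \<open>lml\<close> only, likewise the class of \<open>mml\<close> in \<open>mlm\<close>
  only, and these two words are adjacent. The set \<open>N\<close> in the proof collects the ordered pairs
  whose class is lost; it contains every pair of distinct loops in at least one of the two orders.
\<close>

lemma card_missed_ge:
  assumes S: "indep d S"
  shows "3 * (card (loops S) * card (loops S)) \<le> 2 * card (missed d S) + 3 * card (loops S)"
proof -
  let ?L = "loops S"
  define N where "N = {(l, m). l \<in> ?L \<and> m \<in> ?L \<and> l \<noteq> m \<and> (l, m, l) \<notin> S}"
  have finL: "finite ?L" and Ld: "?L \<subseteq> {..<d}" using card_loops[OF S] by auto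
  have finN: "finite N"
    by (rule finite_subset[of _ "?L \<times> ?L"]) (auto simp: N_def finL)
  have "?L \<times> ?L \<subseteq> (\<lambda>l. (l, l)) ` ?L \<union> (N \<union> N\<inverse>)"
  proof (rule subsetI, rule ccontr)
    fix p assume p: "p \<in> ?L \<times> ?L" "p \<notin> (\<lambda>l. (l, l)) ` ?L \<union> (N \<union> N\<inverse>)"
    obtain l m where lm: "p = (l, m)" by (cases p)
    have "(l, m, l) \<in> S" "(m, l, m) \<in> S" "l \<noteq> m" using p by (auto simp: N_def lm)
    then show False using indepD[OF S] by blast
  qed
  then have "card (?L \<times> ?L) \<le> card ((\<lambda>l. (l, l)) ` ?L \<union> (N \<union> N\<inverse>))"
    by (rule card_mono[rotated]) (use finL finN in auto)
  also have "\<dots> \<le> card ((\<lambda>l. (l, l)) ` ?L) + (card N + card (N\<inverse>))"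
    by (meson add_le_mono card_Un_le le_trans order_refl)
  also have "\<dots> \<le> card ?L + 2 * card N"
    using card_image_le[OF finL, of "\<lambda>l. (l, l)"] by (simp add: card_inverse)
  finally have 1: "card ?L * card ?L \<le> card ?L + 2 * card N" by (simp add: card_cartesian_product)
  let ?A = "(\<lambda>(l, m). (l, l, m)) ` N" and ?B = "(\<lambda>(l, m). (l, m, l)) ` N"
    and ?C = "(\<lambda>(l, m). (m, l, l)) ` N"
  have "?A \<union> ?B \<union> ?C \<subseteq> missed d S"
  proof -
    have "(l, l, m) \<notin> S \<and> (l, m, l) \<notin> S \<and> (m, l, l) \<notin> S \<and> l < d \<and> m < d \<and> l \<noteq> m" if "(l, m) \<in> N" for l m
    proof -
      have "(l, l, l) \<in> S" "l \<noteq> m" "(l, m, l) \<notin> S" "l < d" "m < d" using that Ld by (auto simp: N_def loops_def)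
      then show ?thesis using indepD[OF S, of l l l m] indepD[OF S, of m l l l] by auto
    qed
    then show ?thesis
      by (auto simp: missed_def nodes_def diag_def)
  qed
  then have "card (?A \<union> ?B \<union> ?C) \<le> card (missed d S)"
    by (rule card_mono[OF finite_missed])
  moreover have "card (?A \<union> ?B \<union> ?C) = card ?A + card ?B + card ?C"
  proof -
    have "?A \<inter> ?B = {}" "(?A \<union> ?B) \<inter> ?C = {}" by (auto simp: N_def)
    then show ?thesis using finN by (simp add: card_Un_disjoint)
  qed
  moreover have "card ?A = card N" "card ?B = card N" "card ?C = card N"
    by (auto intro!: card_image simp: inj_on_def)
  ultimately have "3 * card N \<le> card (missed d S)" by simp
  with 1 show ?thesis by linarith
qed

text \<open>
  With \<open>k\<close> loops the previous estimates give
  \<open>card S \<le> (d\<^sup>3 - d) / 3 + k - k (k - 1) / 2\<close>. The correction \<open>k - k (k - 1) / 2\<close> is at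
  most \<open>1\<close>, with equality only for \<open>k = 1\<close>, where no class is missed, and \<open>k = 2\<close>, where a single
  class is missed. The bounds are stated without division and subtraction.
\<close>

lemma indep_card_le:
  assumes S: "indep d S"
  shows "3 * card S + d \<le> d ^ 3 + 3"
    and "3 * card S + d = d ^ 3 + 3 \<Longrightarrow>
           card (loops S) = 1 \<and> card (missed d S) = 0 \<or> card (loops S) = 2 \<and> card (missed d S) = 3"
proof -
  let ?k = "card (loops S)" and ?m = "card (missed d S)"
  have 1: "3 * card S + ?m + d = d ^ 3 + 3 * ?k"
    using card_missed[OF S] card_loops(1)[OF S] by simp
  have 2: "3 * (?k * ?k) \<le> 2 * ?m + 3 * ?k"
    using card_missed_ge[OF S] .
  consider "?k = 0" | "?k = 1" | "?k = 2" | "?k \<ge> 3" by linarith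
  then have "3 * card S + d \<le> d ^ 3 + 3 \<and> (3 * card S + d = d ^ 3 + 3 \<longrightarrow> ?k = 1 \<and> ?m = 0 \<or> ?k = 2 \<and> ?m = 3)"
  proof cases
    case 4
    then have "3 * ?k \<le> ?k * ?k" by simp
    then show ?thesis using 1 2 by linarith
  qed (use 1 2 in auto)
  then show "3 * card S + d \<le> d ^ 3 + 3" "3 * card S + d = d ^ 3 + 3 \<Longrightarrow>
           ?k = 1 \<and> ?m = 0 \<or> ?k = 2 \<and> ?m = 3" by auto
qed

section \<open>Maximum independent sets are directed cuts\<close>

text \<open>
  The directed cut given by a relation \<open>E\<close> on the digits: the edges of \<open>B(d,2)\<close> are the words
  \<open>xyz\<close>, seen as edges from \<open>xy\<close> to \<open>yz\<close>, and the cut takes those that leave the set of nodes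
  described by \<open>E\<close>. The nodes \<open>aa\<close> and \<open>bb\<close> lie on neither side; their self-edges \<open>aaa\<close> and \<open>bbb\<close>
  are added instead. A set with only one loop is the case \<open>b = a\<close>.
\<close>

definition dicut :: "nat \<Rightarrow> nat \<Rightarrow> nat \<Rightarrow> (nat \<Rightarrow> nat \<Rightarrow> bool) \<Rightarrow> node set" where
  "dicut d a b E = {(x, y, z). x < d \<and> y < d \<and> z < d \<and> E x y \<and> \<not> E y z
      \<and> \<not> (x = y \<and> x \<in> {a, b}) \<and> \<not> (y = z \<and> z \<in> {a, b})} \<union> {(a, a, a), (b, b, b)}"

text \<open>
  The relations whose cut hits as many rotation classes as possible. Read \<open>E x y\<close> as ``\<open>x\<close> beats
  \<open>y\<close>'': the distinguished loop strictly beats all other digits, the second loop all but the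
  distinguished one. On the remaining digits the rotations of \<open>xyz\<close> compete for the three bits
  \<open>E x y\<close>, \<open>E y z\<close>, \<open>E z x\<close>, and one of them lies in the cut precisely when these bits are not all
  equal.
\<close>

definition profile :: "nat \<Rightarrow> nat \<Rightarrow> nat \<Rightarrow> (nat \<Rightarrow> nat \<Rightarrow> bool) \<Rightarrow> bool" where
  "profile d a b E \<longleftrightarrow> a < d \<and> b < d
     \<and> (\<forall>x<d. x \<noteq> a \<longrightarrow> E a x \<and> \<not> E x a)
     \<and> (\<forall>x<d. x \<noteq> a \<longrightarrow> x \<noteq> b \<longrightarrow> E b x \<and> \<not> E x b)
     \<and> (\<forall>x<d. \<forall>y<d. \<forall>z<d. x \<notin> {a, b} \<longrightarrow> y \<notin> {a, b} \<longrightarrow> z \<notin> {a, b} \<longrightarrow> \<not> (x = y \<and> y = z)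
          \<longrightarrow> \<not> (E x y = E y z \<and> E y z = E z x))"

lemma profileD:
  assumes "profile d a b E"
  shows "a < d" "b < d" "\<And>x. x < d \<Longrightarrow> x \<noteq> a \<Longrightarrow> E a x" "\<And>x. x < d \<Longrightarrow> x \<noteq> a \<Longrightarrow> \<not> E x a"
    "\<And>x. x < d \<Longrightarrow> x \<noteq> a \<Longrightarrow> x \<noteq> b \<Longrightarrow> E b x" "\<And>x. x < d \<Longrightarrow> x \<noteq> a \<Longrightarrow> x \<noteq> b \<Longrightarrow> \<not> E x b"
    "\<And>x y z. x < d \<Longrightarrow> y < d \<Longrightarrow> z < d \<Longrightarrow> x \<notin> {a, b} \<Longrightarrow> y \<notin> {a, b} \<Longrightarrow> z \<notin> {a, b}
       \<Longrightarrow> \<not> (x = y \<and> y = z) \<Longrightarrow> \<not> (E x y = E y z \<and> E y z = E z x)"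
  using assms unfolding profile_def by auto

lemma mem_dicut:
  "(x, y, z) \<in> dicut d a b E \<longleftrightarrow> x < d \<and> y < d \<and> z < d \<and> E x y \<and> \<not> E y z
      \<and> \<not> (x = y \<and> x \<in> {a, b}) \<and> \<not> (y = z \<and> z \<in> {a, b}) \<or> x = y \<and> y = z \<and> z \<in> {a, b}"
  by (auto simp: dicut_def)

lemma dicut_subset: "profile d a b E \<Longrightarrow> dicut d a b E \<subseteq> nodes d"
  by (auto simp: mem_dicut nodes_def profile_def)

lemma indep_dicut:
  assumes "profile d a b E"
  shows "indep d (dicut d a b E)"
proof -
  have "x = y \<and> y = z \<and> z = w" if "(x, y, z) \<in> dicut d a b E" "(y, z, w) \<in> dicut d a b E" for x y z w
    using that unfolding mem_dicut by argo
  then show ?thesis unfolding indep_iff using dicut_subset[OF assms] by blast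
qed

lemma loops_dicut: "loops (dicut d a b E) = {a, b}"
  unfolding loops_def mem_dicut by auto

text \<open>
  A digit \<open>l\<close> that beats both other digits of a word makes sure that one rotation is in the cut:
  if \<open>u\<close> beats \<open>v\<close> it is \<open>uvl\<close>, otherwise \<open>luv\<close>. This fails only if \<open>uv\<close> is the node \<open>bb\<close>, which
  lies on neither side of the cut. Words without loop digits are covered by the last clause of a
  profile.
\<close>

lemma missed_dicut:
  assumes P: "profile d a b E"
  shows "missed d (dicut d a b E) \<subseteq> (if a = b then {} else {(b, b, a), (b, a, b), (a, b, b)})"
proof clarify
  fix x y z assume "(x, y, z) \<in> missed d (dicut d a b E)"
  then have m: "(x, y, z) \<notin> dicut d a b E" "(y, z, x) \<notin> dicut d a b E" "(z, x, y) \<notin> dicut d a b E"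
    and xd: "x < d" "y < d" "z < d" and nd: "\<not> (x = y \<and> y = z)"
    unfolding missed_def nodes_def diag_def by auto
  note p = profileD[OF P]
  \<comment> \<open>a digit \<open>l\<close> beating \<open>u\<close> and \<open>v\<close>: \<open>luv\<close> or \<open>uvl\<close> is in the cut, unless \<open>uv\<close> is a loop pair\<close>
  have beat: "u = v \<and> v \<in> {a, b}"
    if n: "(l, u, v) \<notin> dicut d a b E" "(u, v, l) \<notin> dicut d a b E" "l < d" "u < d" "v < d"
      "u \<noteq> l" "v \<noteq> l" "E l u" "\<not> E v l" for l u v
    using n unfolding mem_dicut by argo
  have beat': False if n: "(l, u, l) \<notin> dicut d a b E" "l < d" "u < d" "u \<noteq> l" "E l u" "\<not> E u l" for l u
    using n unfolding mem_dicut by argo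
  have a_case: "a \<noteq> b \<and> u = b \<and> v = b"
    if n: "(a, u, v) \<notin> dicut d a b E" "(u, v, a) \<notin> dicut d a b E" "(v, a, u) \<notin> dicut d a b E"
      "u < d" "v < d" "\<not> (a = u \<and> u = v)" for u v
  proof (cases "u = a \<or> v = a")
    case True
    then show ?thesis using beat'[of a u] beat'[of a v] n p(1-4) by metis
  next
    case False
    then show ?thesis using beat[of a u v] n p(1,3,4) by blast
  qed
  have b_case: False
    if n: "(b, u, v) \<notin> dicut d a b E" "(u, v, b) \<notin> dicut d a b E" "(v, b, u) \<notin> dicut d a b E"
      "u < d" "v < d" "\<not> (b = u \<and> u = v)" "u \<noteq> a" "v \<noteq> a" for u v
  proof (cases "u = b \<or> v = b")
    case True
    then show ?thesis using beat'[of b u] beat'[of b v] n p(2,5,6) by metis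
  next
    case False
    then show ?thesis using beat[of b u v] n p(2,5,6) by blast
  qed
  have "a \<noteq> b \<and> (x, y, z) \<in> {(b, b, a), (b, a, b), (a, b, b)}"
  proof (cases "a \<in> {x, y, z}")
    case True
    then consider "x = a" | "y = a" | "z = a" by blast
    then show ?thesis
    proof cases
      case 1 then show ?thesis using a_case[of y z] m xd nd by simp
    next
      case 2 then show ?thesis using a_case[of z x] m xd nd by auto
    next
      case 3 then show ?thesis using a_case[of x y] m xd nd by auto
    qed
  next
    case False
    then have na: "x \<noteq> a" "y \<noteq> a" "z \<noteq> a" by auto
    then have nb: "x \<noteq> b" "y \<noteq> b" "z \<noteq> b"
      using b_case[of y z] b_case[of z x] b_case[of x y] m xd nd by auto
    have "\<not> (E x y = E y z \<and> E y z = E z x)" using p(7)[of x y z] na nb xd nd by blast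
    then show ?thesis using m na nb xd unfolding mem_dicut by simp argo
  qed
  then show "(x, y, z) \<in> (if a = b then {} else {(b, b, a), (b, a, b), (a, b, b)})" by presburger
qed

lemma card_dicut:
  assumes P: "profile d a b E"
  shows "3 * card (dicut d a b E) + d = d ^ 3 + 3"
proof -
  let ?S = "dicut d a b E"
  note S = indep_dicut[OF P]
  have 1: "3 * card ?S + card (missed d ?S) + d = d ^ 3 + 3 * card {a, b}"
    using card_missed[OF S] card_loops(1)[OF S] loops_dicut[of d a b E] by simp
  have "card (missed d ?S) \<le> card (if a = b then {} else {(b, b, a), (b, a, b), (a, b, b)})"
    by (rule card_mono[OF _ missed_dicut[OF P]]) auto
  then have "card (missed d ?S) \<le> 3 * (card {a, b} - 1)"
    by (cases "a = b") (auto simp: card_insert_if)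
  moreover have "card {a, b} \<ge> 1" by (cases "a = b") auto
  ultimately show ?thesis using 1 indep_card_le(1)[OF S] by linarith
qed

text \<open>
  The bound is attained by the cut of any strict linear order, with \<open>0\<close> as the only loop; so the
  maximum cardinality is known.
\<close>

lemma MIS_iff_card:
  assumes d: "d \<ge> 1"
  shows "S \<in> MIS d \<longleftrightarrow> indep d S \<and> 3 * card S + d = d ^ 3 + 3"
proof
  have P: "profile d 0 0 (\<lambda>x y. x < y)" using d by (auto simp: profile_def)
  assume S: "S \<in> MIS d"
  then have "card (dicut d 0 0 (\<lambda>x y. x < y)) \<le> card S"
    using indep_dicut[OF P] by (auto simp: MIS_def)
  then show "indep d S \<and> 3 * card S + d = d ^ 3 + 3"
    using S indep_card_le(1)[of d S] card_dicut[OF P] by (auto simp: MIS_def)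
next
  assume S: "indep d S \<and> 3 * card S + d = d ^ 3 + 3"
  then have "card T \<le> card S" if "indep d T" for T
    using indep_card_le(1)[OF that] by linarith
  then show "S \<in> MIS d" using S by (auto simp: MIS_def)
qed

lemma dicut_in_MIS: "profile d a b E \<Longrightarrow> dicut d a b E \<in> MIS d"
  using MIS_iff_card[of d] indep_dicut card_dicut profileD(1)[of d a b E] by auto

definition starts :: "node set \<Rightarrow> nat \<Rightarrow> nat \<Rightarrow> bool" where
  "starts S x y \<longleftrightarrow> (\<exists>z. (x, y, z) \<in> S)"

text \<open>
  If there are two loops, then the missed class is that of \<open>mml\<close> or that of \<open>llm\<close>, since \<open>lml\<close> and
  \<open>mlm\<close> are adjacent. The loop called \<open>b\<close> is the one that occurs twice in the missed words, and
  \<open>a\<close> is the distinguished loop.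
\<close>

lemma MIS_loops:
  assumes d: "d \<ge> 1" and S: "S \<in> MIS d"
  shows "\<exists>a b. loops S = {a, b} \<and> missed d S \<subseteq> {(b, b, a), (b, a, b), (a, b, b)}"
proof -
  have I: "indep d S" and c: "3 * card S + d = d ^ 3 + 3" using S d by (simp_all add: MIS_iff_card)
  consider "card (loops S) = 1" "card (missed d S) = 0" | "card (loops S) = 2" "card (missed d S) = 3"
    using indep_card_le(2)[OF I c] by metis
  then show ?thesis
  proof cases
    case 1
    then obtain a where "loops S = {a}" using card_1_singletonE by blast
    moreover have "missed d S = {}" using 1 finite_missed by simp
    ultimately show ?thesis by (intro exI[of _ a]) simp
  next
    case 2
    then obtain l' m' where L': "loops S = {l', m'}" "l' \<noteq> m'" by (auto simp: card_2_iff)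
    have "(m', l', m') \<notin> S \<or> (l', m', l') \<notin> S"
      using indepD[OF I, of m' l' m' l'] L'(2) by metis
    then obtain l m where L: "loops S = {l, m}" and lm: "l \<noteq> m" "(m, l, m) \<notin> S"
      using L' insert_commute by metis
    have ld: "l < d" "m < d" using card_loops(3)[OF I] L by simp_all
    have "m \<in> loops S" using L by simp
    then have "(m, m, m) \<in> S" by (simp add: loops_def)
    then have "(m, m, l) \<notin> S" "(l, m, m) \<notin> S"
      using indepD[OF I, of m m m l] indepD[OF I, of l m m m] lm by metis+
    then have sub: "{(m, m, l), (m, l, m), (l, m, m)} \<subseteq> missed d S"
      using lm ld by (simp add: missed_def nodes_def diag_def)
    have "card {(m, m, l), (m, l, m), (l, m, m)} = 3" using lm by simp
    then have "{(m, m, l), (m, l, m), (l, m, m)} = missed d S"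
      using card_subset_eq[OF finite_missed sub] 2(2) by simp
    then show ?thesis using L by blast
  qed
qed

text \<open>
  The relation is recovered from \<open>S\<close>: \<open>x\<close> beats \<open>y\<close> if some word of \<open>S\<close> starts with \<open>xy\<close>. Such a
  pair cannot also end a word of \<open>S\<close>, by independence. Conversely, if \<open>xy\<close> starts a word of \<open>S\<close>,
  \<open>yz\<close> starts none and neither pair is a loop, then the rotation class of \<open>xyz\<close> has to be hit in
  \<open>xyz\<close> itself: \<open>yzx\<close> would make \<open>yz\<close> a start, and \<open>zxy\<close> would be adjacent to a word starting with
  \<open>xy\<close>.
\<close>

theorem MIS_is_dicut:
  assumes d: "d \<ge> 1" and S: "S \<in> MIS d"
  obtains a b where "profile d a b (starts S)" "S = dicut d a b (starts S)"
proof -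
  obtain a b where L: "loops S = {a, b}" and M: "missed d S \<subseteq> {(b, b, a), (b, a, b), (a, b, b)}"
    using MIS_loops[OF d S] by blast
  have I: "indep d S" using S by (simp add: MIS_def)
  have Sd: "\<And>x y z. (x, y, z) \<in> S \<Longrightarrow> x < d \<and> y < d \<and> z < d"
    using indep_subset[OF I] by (auto simp: nodes_def)
  have ab: "(a, a, a) \<in> S" "(b, b, b) \<in> S" using L by (auto simp: loops_def)
  have hit: "(x, y, z) \<in> S \<or> (y, z, x) \<in> S \<or> (z, x, y) \<in> S \<or> (x, y, z) \<in> {(b, b, a), (b, a, b), (a, b, b)}"
    if "x < d" "y < d" "z < d" "\<not> (x = y \<and> y = z)" for x y z
  proof -
    have "(x, y, z) \<in> nodes d - diag" using that by (auto simp: nodes_def diag_def)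
    then have "(x, y, z) \<in> missed d S \<or> (x, y, z) \<in> S \<or> (y, z, x) \<in> S \<or> (z, x, y) \<in> S"
      by (auto simp: missed_def)
    then show ?thesis using M by blast
  qed
  have adj: "x = y \<and> y = z \<and> z = w" if "(x, y, z) \<in> S" "(y, z, w) \<in> S" for x y z w
    using indepD[OF I that] .
  have ll: "l \<in> {a, b} \<Longrightarrow> x \<noteq> l \<Longrightarrow> (l, l, x) \<notin> S \<and> (x, l, l) \<notin> S" for l x
    using adj[of l l l x] adj[of x l l l] ab by auto
  have axa: "(a, x, a) \<in> S" if "x < d" "x \<noteq> a" for x
    using hit[of a x a] ll[of a x] that Sd ab by auto
  have bxb: "(b, x, b) \<in> S" if "x < d" "x \<noteq> a" "x \<noteq> b" for x
    using hit[of b x b] ll[of b x] that Sd ab by auto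
  have sx: "\<not> starts S y z" if "(x, y, z) \<in> S" "\<not> (x = y \<and> y = z)" for x y z
    using adj[OF that(1)] that(2) unfolding starts_def by metis
  have P: "profile d a b (starts S)"
    unfolding profile_def
  proof (intro conjI allI impI)
    show "a < d" "b < d" using Sd ab by auto
    show "starts S a x" "\<not> starts S x a" if "x < d" "x \<noteq> a" for x
      using axa[OF that] sx[of a x a] that by (auto simp: starts_def)
    show "starts S b x" "\<not> starts S x b" if "x < d" "x \<noteq> a" "x \<noteq> b" for x
      using bxb[OF that] sx[of b x b] that by (auto simp: starts_def)
    fix x y z assume "x < d" "y < d" "z < d" "x \<notin> {a, b}" "y \<notin> {a, b}" "z \<notin> {a, b}"
      and nd: "\<not> (x = y \<and> y = z)"
    then have "(x, y, z) \<in> S \<or> (y, z, x) \<in> S \<or> (z, x, y) \<in> S"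
      using hit[of x y z] by auto
    then show "\<not> (starts S x y = starts S y z \<and> starts S y z = starts S z x)"
      using sx[of x y z] sx[of y z x] sx[of z x y] nd by (auto simp: starts_def)
  qed
  moreover have "S = dicut d a b (starts S)"
  proof -
    have "(x, y, z) \<in> dicut d a b (starts S)" if xyz: "(x, y, z) \<in> S" for x y z
    proof (cases "x = y \<and> y = z")
      case True
      then have "z \<in> loops S" using xyz by (simp add: loops_def)
      then show ?thesis using True L unfolding mem_dicut by simp
    next
      case False
      have "starts S x y" using xyz unfolding starts_def by blast
      moreover have "\<not> (x = y \<and> x \<in> {a, b})" using ll[of x z] xyz False by metis
      moreover have "\<not> (y = z \<and> z \<in> {a, b})" using ll[of z x] xyz False by metis
      ultimately show ?thesis
        using Sd[OF xyz] sx[OF xyz False] unfolding mem_dicut by metis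
    qed
    moreover have "(x, y, z) \<in> S" if xyz: "(x, y, z) \<in> dicut d a b (starts S)" for x y z
    proof (cases "x = y \<and> y = z")
      case True
      then have "z \<in> {a, b}" using xyz unfolding mem_dicut by auto
      then show ?thesis using True ab by auto
    next
      case nd: False
      then have *: "x < d" "y < d" "z < d" "starts S x y" "\<not> starts S y z"
         "\<not> (x = y \<and> x \<in> {a, b})" "\<not> (y = z \<and> z \<in> {a, b})"
        using xyz unfolding mem_dicut by argo+
      obtain w where w: "(x, y, w) \<in> S" using *(4) unfolding starts_def by blast
      have "(y, z, x) \<notin> S" using *(5) unfolding starts_def by blast
      moreover have "(z, x, y) \<notin> S" using adj[OF _ w] nd by metis
      moreover have "(x, y, z) \<noteq> (b, b, a)" "(x, y, z) \<noteq> (a, b, b)" using * by auto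
      moreover have "(x, y, z) \<noteq> (b, a, b)"
      proof
        assume eq: "(x, y, z) = (b, a, b)"
        then have "(a, b, a) \<in> S" using axa[of b] * nd by auto
        then show False using adj[of a b a w] w eq nd by auto
      qed
      ultimately show ?thesis using hit[OF *(1-3) nd] by blast
    qed
    ultimately show ?thesis by auto
  qed
  ultimately show thesis by (rule that)
qed

section \<open>Permuting the digits\<close>

text \<open>
  The inverse function; the shorter notation is used here for inverses in groups.
\<close>

abbreviation pinv :: "(nat \<Rightarrow> nat) \<Rightarrow> nat \<Rightarrow> nat" where
  "pinv p \<equiv> inv_into UNIV p"

lemma map_node_comp: "map_node p (map_node q w) = map_node (p \<circ> q) w"
  by (cases w) simp

lemma act_comp: "act p (act q S) = act (p \<circ> q) S"
  unfolding act_def image_image map_node_comp ..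

lemma map_node_id: "map_node id w = w"
  by (cases w) simp

lemma act_id: "act id S = S"
  by (simp add: act_def map_node_id)

lemma act_inv:
  assumes "p permutes A"
  shows "act (pinv p) (act p S) = S" "act p (act (pinv p) S) = S"
  using permutes_inv_o[OF assms] by (simp_all add: act_comp act_id)

lemma mem_act:
  assumes p: "p permutes A"
  shows "(x, y, z) \<in> act p S \<longleftrightarrow> (pinv p x, pinv p y, pinv p z) \<in> S"
proof
  assume "(x, y, z) \<in> act p S"
  then obtain w where "w \<in> S" "(x, y, z) = map_node p w" unfolding act_def by blast
  then show "(pinv p x, pinv p y, pinv p z) \<in> S"
    by (cases w) (simp add: permutes_inverses[OF p])
next
  assume "(pinv p x, pinv p y, pinv p z) \<in> S"
  then have "map_node p (pinv p x, pinv p y, pinv p z) \<in> act p S" unfolding act_def by (rule imageI)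
  then show "(x, y, z) \<in> act p S" by (simp add: permutes_inverses[OF p])
qed

lemma permutes_less: "p permutes {..<d} \<Longrightarrow> p x < d \<longleftrightarrow> x < (d :: nat)"
  using permutes_in_image[of p "{..<d}" x] by simp

lemma permutes_inv_less: "p permutes {..<d} \<Longrightarrow> pinv p x < d \<longleftrightarrow> x < (d :: nat)"
  by (rule permutes_less[OF permutes_inv])

lemma node_set_eqI: "(\<And>x y z. (x, y, z) \<in> S \<longleftrightarrow> (x, y, z) \<in> T) \<Longrightarrow> S = (T :: node set)"
  by auto

lemma act_dicut:
  assumes p: "p permutes {..<d}"
  shows "act p (dicut d a b E) = dicut d (p a) (p b) (\<lambda>x y. E (pinv p x) (pinv p y))"
proof (rule node_set_eqI)
  fix x y z
  have 1: "pinv p u = c \<longleftrightarrow> u = p c" for u c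
    using permutes_inverses[OF p] by metis
  have 2: "pinv p u = pinv p v \<longleftrightarrow> u = v" for u v
    using permutes_inverses[OF p] by metis
  show "(x, y, z) \<in> act p (dicut d a b E)
      \<longleftrightarrow> (x, y, z) \<in> dicut d (p a) (p b) (\<lambda>x y. E (pinv p x) (pinv p y))"
    unfolding mem_act[OF p] mem_dicut insert_iff 1 2 permutes_inv_less[OF p]
    by (simp add: permutes_inverses[OF p])
qed

lemma profile_act:
  assumes p: "p permutes {..<d}" and P: "profile d a b E"
  shows "profile d (p a) (p b) (\<lambda>x y. E (pinv p x) (pinv p y))"
proof -
  have 1: "u = p c \<longleftrightarrow> pinv p u = c" for u c
    using permutes_inverses[OF p] by metis
  have 2: "pinv p u = pinv p v \<longleftrightarrow> u = v" for u v
    using permutes_inverses[OF p] by metis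
  note Q = profileD[OF P]
  show ?thesis
    unfolding profile_def insert_iff empty_iff 1
  proof (intro conjI allI impI, goal_cases)
    case (7 x y z)
    then show ?case using Q(7)[of "pinv p x" "pinv p y" "pinv p z"] by (simp add: permutes_inv_less[OF p] 2)
  qed (simp_all add: Q permutes_inv_less[OF p] permutes_less[OF p] permutes_inverses[OF p])
qed

lemma dicut_cong:
  assumes "\<And>x y. x < d \<Longrightarrow> y < d \<Longrightarrow> \<not> (x = y \<and> x \<in> {a, b}) \<Longrightarrow> E x y = E' x y"
  shows "dicut d a b E = dicut d a b E'"
proof (rule node_set_eqI)
  fix x y z
  show "(x, y, z) \<in> dicut d a b E \<longleftrightarrow> (x, y, z) \<in> dicut d a b E'"
    unfolding mem_dicut using assms[of x y] assms[of y z] by metis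
qed

text \<open>
  The relation of a cut is determined by the cut, up to its values at the loops: if \<open>x\<close> beats \<open>y\<close>,
  then \<open>y\<close> is not \<open>a\<close>, and since nothing beats \<open>a\<close>, the word \<open>xya\<close> lies in the cut.
\<close>

lemma starts_dicut:
  assumes P: "profile d a b E" and "x < d" "y < d" "\<not> (x = y \<and> x \<in> {a, b})"
  shows "starts (dicut d a b E) x y \<longleftrightarrow> E x y"
proof
  assume "starts (dicut d a b E) x y"
  then show "E x y" using assms(4) unfolding starts_def mem_dicut by auto
next
  assume E: "E x y"
  have "y \<noteq> a" using E assms profileD(4)[OF P, of x] by auto
  then have "(x, y, a) \<in> dicut d a b E"
    using E assms profileD(1)[OF P] profileD(4)[OF P, of y] unfolding mem_dicut by auto
  then show "starts (dicut d a b E) x y" unfolding starts_def by blast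
qed

text \<open>
  The second loop is not distinguished: it does not beat \<open>a\<close>, so \<open>bab\<close> is not in the cut.
\<close>

lemma dist_loop_dicut:
  assumes P: "profile d a b E"
  shows "dist_loop d (dicut d a b E) = a"
  unfolding dist_loop_def
proof (rule the_equality)
  note p = profileD[OF P]
  have "(a, y, a) \<in> dicut d a b E" if "y < d" for y
    using p(1) p(3,4)[OF that] that unfolding mem_dicut by auto
  then show "a \<in> loops (dicut d a b E) \<and> (\<forall>y<d. (a, y, a) \<in> dicut d a b E)"
    by (simp add: loops_dicut)
next
  fix l assume l: "l \<in> loops (dicut d a b E) \<and> (\<forall>y<d. (l, y, l) \<in> dicut d a b E)"
  note p = profileD[OF P]
  have "(l, a, l) \<in> dicut d a b E" using l p(1) by simp
  then show "l = a" using p(4)[of l] unfolding mem_dicut by auto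
qed

section \<open>The operators put a new block on top\<close>

fun oper_type :: "oper \<Rightarrow> bool" where
  "oper_type Op_f = True" | "oper_type Op_f' = False" | "oper_type Op_g = True" | "oper_type Op_g' = False"

text \<open>
  A common form of the four operators. The new digits form the block \<open>Y\<close>, and the bit \<open>t\<close>
  separates \<open>f\<close>, \<open>g\<close> from \<open>f'\<close>, \<open>g'\<close>. For a block with one element all parts with \<open>y \<noteq> z\<close>
  are empty.
\<close>

definition extend :: "nat set \<Rightarrow> bool \<Rightarrow> nat \<Rightarrow> node set \<Rightarrow> node set" where
  "extend Y t d S = (let a = dist_loop d S; L = loops S in
     S
     \<union> {replace_digit a y w | y w. y \<in> Y \<and> w \<in> replaceable d S}
     \<union> {(a, x, y) | x y. x \<in> {..<d} - L \<and> y \<in> Y}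
     \<union> {(y, x, a) | x y. x \<in> {..<d} - L \<and> y \<in> Y}
     \<union> {(y, x, z) | x y z. y \<in> Y \<and> z \<in> Y \<and> y \<noteq> z \<and> x \<in> {..<d} - L}
     \<union> {(u, y, v) | u v y. u \<in> L \<and> v \<in> L \<and> y \<in> Y}
     \<union> (if t
        then {(u, y, y) | u y. u \<in> L \<and> y \<in> Y} \<union> {(y, z, u) | u y z. y \<in> Y \<and> z \<in> Y \<and> y \<noteq> z \<and> u \<in> L}
          \<union> {(y, z, z) | y z. y \<in> Y \<and> z \<in> Y \<and> y \<noteq> z}
        else {(y, y, u) | u y. u \<in> L \<and> y \<in> Y} \<union> {(u, y, z) | u y z. y \<in> Y \<and> z \<in> Y \<and> y \<noteq> z \<and> u \<in> L}
          \<union> {(y, y, z) | y z. y \<in> Y \<and> z \<in> Y \<and> y \<noteq> z}))"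

lemma oper_fun_extend: "oper_fun F d S = extend {d..<d + oper_incr F} (oper_type F) d S"
proof -
  have 1: "{d..<d + 1} = {d}" and 2: "{d..<d + 2} = {d, d + 1}" by auto
  have 3: "{(y, z, z) | y z. y \<in> {d, d + 1} \<and> z \<in> {d, d + 1} \<and> y \<noteq> z} = {(d, d + 1, d + 1), (d + 1, d, d)}"
    and 4: "{(y, y, z) | y z. y \<in> {d, d + 1} \<and> z \<in> {d, d + 1} \<and> y \<noteq> z} = {(d + 1, d + 1, d), (d, d, d + 1)}"
    by auto
  show ?thesis
  proof (cases F)
    case Op_f
    then show ?thesis
      unfolding Op_f oper_fun.simps oper_incr.simps oper_type.simps extend_def op_f_def f_base_def Let_def 1 if_True
      by (auto; fail)
  next
    case Op_f'
    then show ?thesis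
      unfolding Op_f' oper_fun.simps oper_incr.simps oper_type.simps extend_def op_f'_def f_base_def Let_def 1 if_False
      by (auto; fail)
  next
    case Op_g
    then show ?thesis
      unfolding Op_g oper_fun.simps oper_incr.simps oper_type.simps extend_def op_g_def g_base_def Let_def 2 if_True 3
      by (simp only: Un_assoc)
  next
    case Op_g'
    then show ?thesis
      unfolding Op_g' oper_fun.simps oper_incr.simps oper_type.simps extend_def op_g'_def g_base_def Let_def 2 if_False 4
      by (simp only: Un_assoc)
  qed
qed

text \<open>
  In a cut a word containing \<open>a\<close> has it at its first or last position, unless it is \<open>aaa\<close>, because
  nothing beats \<open>a\<close>. Replacing \<open>a\<close> by a new digit \<open>u\<close> therefore makes \<open>u\<close> beat the same non-loop
  digits as \<open>a\<close> does.
\<close>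

lemma mem_replaced:
  assumes P: "profile d a b E"
  shows "(x, y, z) \<in> {replace_digit a u w | u w. u \<in> Y \<and> w \<in> replaceable d (dicut d a b E)} \<longleftrightarrow>
    y < d \<and> y \<notin> {a, b} \<and> (x \<in> Y \<and> (z = x \<or> z < d \<and> z \<noteq> a \<and> \<not> E y z) \<or> z \<in> Y \<and> x < d \<and> x \<noteq> a \<and> E x y)"
proof -
  let ?S = "dicut d a b E"
  note p = profileD[OF P]
  have R: "w \<in> replaceable d ?S \<longleftrightarrow> (\<exists>v. v < d \<and> v \<notin> {a, b} \<and> (w = (a, v, a)
      \<or> (\<exists>r<d. r \<noteq> a \<and> \<not> E v r \<and> w = (a, v, r)) \<or> (\<exists>r<d. r \<noteq> a \<and> E r v \<and> w = (r, v, a))))" (is "_ \<longleftrightarrow> ?R w") for w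
  proof -
    obtain u v r where w: "w = (u, v, r)" by (cases w)
    have 1: "w \<in> replaceable d ?S \<longleftrightarrow> w \<in> ?S \<and> (u = a \<or> v = a \<or> r = a) \<and> w \<noteq> (a, a, a) \<and> w \<noteq> (a, b, a)"
      unfolding replaceable_def Let_def dist_loop_dicut[OF P] loops_dicut w by auto
    show ?thesis
    proof
      assume "w \<in> replaceable d ?S"
      then have *: "(u, v, r) \<in> ?S" "u = a \<or> v = a \<or> r = a" "(u, v, r) \<noteq> (a, a, a)" "(u, v, r) \<noteq> (a, b, a)"
        using 1 w by auto
      then have nd: "\<not> (u = v \<and> v = r)" by auto
      then have l: "u < d" "v < d" "r < d" "E u v" "\<not> E v r" "\<not> (u = v \<and> u \<in> {a, b})" "\<not> (v = r \<and> r \<in> {a, b})"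
        using *(1) unfolding mem_dicut by auto
      have va: "v \<noteq> a" using l p(4)[of u] by auto
      have vb: "v \<noteq> b"
        using l *(2-4) va p(6)[of u] p(5)[of r] by auto
      show "?R w" unfolding w using va vb l *(2) by auto
    next
      assume "?R w"
      then have *: "v < d" "v \<noteq> a" "v \<noteq> b" "u = a \<and> r = a \<or> u = a \<and> r < d \<and> r \<noteq> a \<and> \<not> E v r
         \<or> u < d \<and> u \<noteq> a \<and> E u v \<and> r = a" unfolding w by auto
      have "E u v" "\<not> E v r" "u < d" "r < d" using * p(1) p(3)[of v] p(4)[of v] by auto
      then have "(u, v, r) \<in> ?S" using * unfolding mem_dicut by auto
      then show "w \<in> replaceable d ?S" using 1 * unfolding w by auto
    qed
  qed
  have E: "(x, y, z) \<in> {replace_digit a u w | u w. u \<in> Y \<and> w \<in> replaceable d ?S} \<longleftrightarrow>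
     (\<exists>u\<in>Y. \<exists>v. v < d \<and> v \<notin> {a, b} \<and> ((x, y, z) = (u, v, u) \<or> (\<exists>r<d. r \<noteq> a \<and> \<not> E v r \<and> (x, y, z) = (u, v, r))
      \<or> (\<exists>r<d. r \<noteq> a \<and> E r v \<and> (x, y, z) = (r, v, u))))" (is "?l \<longleftrightarrow> ?r")
  proof
    have rep: "replace_digit a u (a, v, a) = (u, v, u)" "r \<noteq> a \<Longrightarrow> replace_digit a u (a, v, r) = (u, v, r)"
      "r \<noteq> a \<Longrightarrow> replace_digit a u (r, v, a) = (r, v, u)" if "v \<noteq> a" for u v r
      using that by (simp_all add: replace_digit_def)
    {
      assume ?l
      then obtain u w where uw: "u \<in> Y" "?R w" "(x, y, z) = replace_digit a u w" unfolding R by blast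
      then obtain v where v: "v < d" "v \<notin> {a, b}" "w = (a, v, a)
      \<or> (\<exists>r<d. r \<noteq> a \<and> \<not> E v r \<and> w = (a, v, r)) \<or> (\<exists>r<d. r \<noteq> a \<and> E r v \<and> w = (r, v, a))" by blast
      then have va: "v \<noteq> a" by blast
      have "(x, y, z) = (u, v, u) \<or> (\<exists>r<d. r \<noteq> a \<and> \<not> E v r \<and> (x, y, z) = (u, v, r))
           \<or> (\<exists>r<d. r \<noteq> a \<and> E r v \<and> (x, y, z) = (r, v, u))"
        using v(3)
      proof (elim disjE exE conjE)
        assume "w = (a, v, a)"
        then show ?thesis using uw(3) rep(1)[OF va, of u] by metis
      next
        fix r assume "r < d" "r \<noteq> a" "\<not> E v r" "w = (a, v, r)"
        then show ?thesis using uw(3) rep(2)[OF va, of r u] by metis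
      next
        fix r assume "r < d" "r \<noteq> a" "E r v" "w = (r, v, a)"
        then show ?thesis using uw(3) rep(3)[OF va, of r u] by metis
      qed
      then show ?r using uw(1) v(1,2) by blast
    next
      assume ?r
      then obtain u v where u: "u \<in> Y" and v: "v < d" "v \<notin> {a, b}" and
        c: "(x, y, z) = (u, v, u) \<or> (\<exists>r<d. r \<noteq> a \<and> \<not> E v r \<and> (x, y, z) = (u, v, r))
           \<or> (\<exists>r<d. r \<noteq> a \<and> E r v \<and> (x, y, z) = (r, v, u))" by blast
      have va: "v \<noteq> a" using v by blast
      have "\<exists>w. ?R w \<and> (x, y, z) = replace_digit a u w"
        using c
      proof (elim disjE exE conjE)
        assume "(x, y, z) = (u, v, u)"
        then show ?thesis using v rep(1)[OF va, of u] by (intro exI[of _ "(a, v, a)"]) metis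
      next
        fix r assume "r < d" "r \<noteq> a" "\<not> E v r" "(x, y, z) = (u, v, r)"
        then show ?thesis using v rep(2)[OF va, of r u] by (intro exI[of _ "(a, v, r)"]) metis
      next
        fix r assume "r < d" "r \<noteq> a" "E r v" "(x, y, z) = (r, v, u)"
        then show ?thesis using v rep(3)[OF va, of r u] by (intro exI[of _ "(r, v, a)"]) metis
      qed
      then show ?l unfolding R using u by blast
    }
  qed
  show ?thesis unfolding E by auto
qed

lemma mem_extend:
  assumes P: "profile d a b E"
  shows "(x, y, z) \<in> extend Y t d (dicut d a b E) \<longleftrightarrow> (x, y, z) \<in> dicut d a b E
    \<or> y < d \<and> y \<notin> {a, b} \<and> (x \<in> Y \<and> (z \<in> Y \<or> z = a \<or> z < d \<and> \<not> E y z) \<or> z \<in> Y \<and> (x = a \<or> x < d \<and> E x y))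
    \<or> y \<in> Y \<and> (x \<in> {a, b} \<and> z \<in> {a, b}
        \<or> (if t then x \<in> {a, b} \<and> z = y \<or> x \<in> Y \<and> x \<noteq> y \<and> (z \<in> {a, b} \<or> z = y)
           else x = y \<and> z \<in> {a, b} \<or> z \<in> Y \<and> z \<noteq> y \<and> (x \<in> {a, b} \<or> x = y)))"
proof -
  let ?L = "{a, b}" and ?N = "{..<d} - {a, b}"
  have parts:
    "(x, y, z) \<in> {(a, x, y) | x y. x \<in> ?N \<and> y \<in> Y} \<longleftrightarrow> x = a \<and> y \<in> ?N \<and> z \<in> Y"
    "(x, y, z) \<in> {(y, x, a) | x y. x \<in> ?N \<and> y \<in> Y} \<longleftrightarrow> x \<in> Y \<and> y \<in> ?N \<and> z = a"
    "(x, y, z) \<in> {(y, x, z) | x y z. y \<in> Y \<and> z \<in> Y \<and> y \<noteq> z \<and> x \<in> ?N} \<longleftrightarrow> x \<in> Y \<and> y \<in> ?N \<and> z \<in> Y \<and> x \<noteq> z"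
    "(x, y, z) \<in> {(u, y, v) | u v y. u \<in> ?L \<and> v \<in> ?L \<and> y \<in> Y} \<longleftrightarrow> x \<in> ?L \<and> y \<in> Y \<and> z \<in> ?L"
    "(x, y, z) \<in> {(u, y, y) | u y. u \<in> ?L \<and> y \<in> Y} \<longleftrightarrow> x \<in> ?L \<and> y \<in> Y \<and> z = y"
    "(x, y, z) \<in> {(y, z, u) | u y z. y \<in> Y \<and> z \<in> Y \<and> y \<noteq> z \<and> u \<in> ?L} \<longleftrightarrow> x \<in> Y \<and> y \<in> Y \<and> x \<noteq> y \<and> z \<in> ?L"
    "(x, y, z) \<in> {(y, z, z) | y z. y \<in> Y \<and> z \<in> Y \<and> y \<noteq> z} \<longleftrightarrow> x \<in> Y \<and> y \<in> Y \<and> x \<noteq> y \<and> z = y"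
    "(x, y, z) \<in> {(y, y, u) | u y. u \<in> ?L \<and> y \<in> Y} \<longleftrightarrow> x = y \<and> y \<in> Y \<and> z \<in> ?L"
    "(x, y, z) \<in> {(u, y, z) | u y z. y \<in> Y \<and> z \<in> Y \<and> y \<noteq> z \<and> u \<in> ?L} \<longleftrightarrow> x \<in> ?L \<and> y \<in> Y \<and> z \<in> Y \<and> y \<noteq> z"
    "(x, y, z) \<in> {(y, y, z) | y z. y \<in> Y \<and> z \<in> Y \<and> y \<noteq> z} \<longleftrightarrow> x = y \<and> y \<in> Y \<and> z \<in> Y \<and> y \<noteq> z"
    by auto
  have N: "y \<in> ?N \<longleftrightarrow> y < d \<and> y \<notin> {a, b}" by auto
  show ?thesis
    unfolding extend_def Let_def dist_loop_dicut[OF P] loops_dicut Un_iff mem_replaced[OF P] if_distrib[of "\<lambda>A. (x, y, z) \<in> A"] parts N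
    using profileD(3,4)[OF P, of y]
    by (cases t) auto
qed

text \<open>
  The relation after an operator has been applied: the new digits beat all old digits except for
  the loops. Within the block of new digits distinct digits beat each other if and only if \<open>t\<close>
  holds, and a digit beats itself if and only if \<open>t\<close> fails.
\<close>

definition put_on_top :: "nat \<Rightarrow> nat \<Rightarrow> nat \<Rightarrow> bool \<Rightarrow> (nat \<Rightarrow> nat \<Rightarrow> bool) \<Rightarrow> nat \<Rightarrow> nat \<Rightarrow> bool" where
  "put_on_top d a b t E x y =
     (if x < d then if y < d then E x y else x \<in> {a, b}
      else if y < d then y \<notin> {a, b} else (x = y) \<noteq> t)"

text \<open>
  The parts of an operator list the words of the new cut that contain a new digit, sorted by the
  positions of the new digits and of the loops, so only a case distinction on the new digits is
  left.
\<close>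

lemma oper_fun_dicut:
  assumes P: "profile d a b E"
  shows "oper_fun F d (dicut d a b E) = dicut (d + oper_incr F) a b (put_on_top d a b (oper_type F) E)"
  unfolding oper_fun_extend
proof (rule node_set_eqI)
  fix x y z
  note p = profileD[OF P]
  have Y: "u \<in> {d..<d + oper_incr F} \<longleftrightarrow> \<not> u < d \<and> u < d + oper_incr F" for u by auto
  have lt: "u < d \<Longrightarrow> u < d + oper_incr F" for u by simp
  show "(x, y, z) \<in> extend {d..<d + oper_incr F} (oper_type F) d (dicut d a b E) \<longleftrightarrow>
     (x, y, z) \<in> dicut (d + oper_incr F) a b (put_on_top d a b (oper_type F) E)"
    unfolding mem_extend[OF P] mem_dicut put_on_top_def Y
    using p(1,2) lt[of x] lt[of y] lt[of z] p(3)[of y] p(4)[of y]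
    by (cases "x < d"; cases "y < d"; cases "z < d"; cases "oper_type F"; auto)
qed

text \<open>
  A closed walk through both old and new digits steps from an old digit to a new one and from a
  new digit to an old one; the bits of these steps are false and true. A closed walk inside the
  new block repeats a digit, since the block has at most two, and then uses \<open>E x x\<close> as well as
  \<open>E x y\<close>.
\<close>

lemma profile_put_on_top:
  assumes P: "profile d a b E"
  shows "profile (d + oper_incr F) a b (put_on_top d a b (oper_type F) E)"
proof -
  note p = profileD[OF P]
  have n: "u = d \<or> u = d + 1" if "\<not> u < d" "u < d + oper_incr F" for u
    using that by (cases F) auto
  show ?thesis
    unfolding profile_def
  proof (intro conjI allI impI, goal_cases)
    case (7 x y z)
    show ?case
    proof (cases "x < d \<and> y < d \<and> z < d")
      case True
      then show ?thesis using p(7)[of x y z] 7 by (simp add: put_on_top_def)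
    next
      case False
      show ?thesis
      proof (cases "x < d \<or> y < d \<or> z < d")
        case True
        then show ?thesis using False 7 unfolding put_on_top_def by argo
      next
        case new: False
        then have "x = y \<or> y = z \<or> z = x" using n[of x] n[of y] n[of z] 7 by auto
        then show ?thesis using new 7 unfolding put_on_top_def by auto
      qed
    qed
  qed (use p in \<open>auto simp: put_on_top_def\<close>)
qed

section \<open>The top block\<close>

definition nonloops :: "nat \<Rightarrow> node set \<Rightarrow> nat set" where
  "nonloops d S = {..<d} - loops S"

text \<open>
  The block that the last operator has added, described by \<open>S\<close> alone and hence respected by every
  permutation of the digits: the non-loop digits that are not strictly beaten by any other one.
\<close>

definition top_digits :: "nat \<Rightarrow> node set \<Rightarrow> nat set" where
  "top_digits d S = {x \<in> nonloops d S. \<forall>y \<in> nonloops d S. y \<noteq> x \<longrightarrow> starts S y x \<longrightarrow> starts S x y}"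

lemma act_MIS:
  assumes "d \<ge> 1" "S \<in> MIS d" "p permutes {..<d}"
  shows "act p S \<in> MIS d"
proof -
  obtain a b where P: "profile d a b (starts S)" and S: "S = dicut d a b (starts S)"
    using MIS_is_dicut[OF assms(1,2)] .
  show ?thesis
    by (subst S, subst act_dicut[OF assms(3)]) (rule dicut_in_MIS[OF profile_act[OF assms(3) P]])
qed

lemma loops_act:
  assumes p: "p permutes A"
  shows "loops (act p S) = p ` loops S"
proof -
  have "x \<in> loops (act p S) \<longleftrightarrow> pinv p x \<in> loops S" for x
    unfolding loops_def by (simp add: mem_act[OF p])
  then show ?thesis
    using permutes_inverses[OF p] by (auto simp: image_iff) metis
qed

lemma starts_act:
  assumes p: "p permutes A"
  shows "starts (act p S) x y \<longleftrightarrow> starts S (pinv p x) (pinv p y)"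
  unfolding starts_def mem_act[OF p] using permutes_inverses[OF p] by metis

lemma nonloops_act:
  assumes p: "p permutes {..<d}"
  shows "nonloops d (act p S) = p ` nonloops d S"
  unfolding nonloops_def loops_act[OF p] image_set_diff[OF permutes_inj[OF p]] permutes_image[OF p] ..

lemma top_digits_act:
  assumes p: "p permutes {..<d}"
  shows "top_digits d (act p S) = p ` top_digits d S"
proof -
  have "p x \<in> top_digits d (act p S) \<longleftrightarrow> x \<in> top_digits d S" for x
    unfolding top_digits_def nonloops_act[OF p] starts_act[OF p]
    by (simp add: permutes_inverses[OF p] inj_image_mem_iff[OF permutes_inj[OF p]] inj_eq[OF permutes_inj[OF p]])
  moreover have "top_digits d (act p S) \<subseteq> range p"
    using permutes_surj[OF p] by simp
  ultimately show ?thesis by blast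
qed

lemma oper_fun_MIS:
  assumes "d \<ge> 1" "S \<in> MIS d"
  shows "oper_fun F d S \<in> MIS (d + oper_incr F)"
proof -
  obtain a b where P: "profile d a b (starts S)" and S: "S = dicut d a b (starts S)"
    using MIS_is_dicut[OF assms] .
  show ?thesis
    by (subst S, subst oper_fun_dicut[OF P]) (rule dicut_in_MIS[OF profile_put_on_top[OF P]])
qed

lemma oper_fun_cases:
  assumes "d \<ge> 1" "S \<in> MIS d"
  obtains a b E where "profile d a b E" "S = dicut d a b E"
    "oper_fun F d S = dicut (d + oper_incr F) a b (put_on_top d a b (oper_type F) E)"
  using MIS_is_dicut[OF assms] oper_fun_dicut by metis

lemma oper_fun_restrict:
  assumes "d \<ge> 1" "S \<in> MIS d"
  shows "oper_fun F d S \<inter> nodes d = S"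
proof -
  obtain a b E where P: "profile d a b E" and S: "S = dicut d a b E"
    and F: "oper_fun F d S = dicut (d + oper_incr F) a b (put_on_top d a b (oper_type F) E)"
    using oper_fun_cases[OF assms] .
  show ?thesis
  proof (rule node_set_eqI)
    fix x y z
    show "(x, y, z) \<in> oper_fun F d S \<inter> nodes d \<longleftrightarrow> (x, y, z) \<in> S"
      unfolding F Int_iff by (subst S) (use profileD(1,2)[OF P] in \<open>auto simp: mem_dicut nodes_def put_on_top_def\<close>)
  qed
qed

lemma starts_oper_fun:
  assumes "d \<ge> 1" "S \<in> MIS d" and x: "x \<in> {d..<d + oper_incr F}"
  shows "starts (oper_fun F d S) x x \<longleftrightarrow> \<not> oper_type F"
proof -
  obtain a b E where P: "profile d a b E" and S: "S = dicut d a b E"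
    and F: "oper_fun F d S = dicut (d + oper_incr F) a b (put_on_top d a b (oper_type F) E)"
    using oper_fun_cases[OF assms(1,2)] .
  show ?thesis
    unfolding F by (subst starts_dicut[OF profile_put_on_top[OF P]]) (use x profileD(1,2)[OF P] in \<open>auto simp: put_on_top_def\<close>)
qed

lemma top_digits_oper_fun:
  assumes "d \<ge> 1" "S \<in> MIS d"
  shows "top_digits (d + oper_incr F) (oper_fun F d S) = {d..<d + oper_incr F}"
proof -
  obtain a b E where P: "profile d a b E" and S: "S = dicut d a b E"
    and F: "oper_fun F d S = dicut (d + oper_incr F) a b (put_on_top d a b (oper_type F) E)"
    using oper_fun_cases[OF assms] .
  let ?D = "d + oper_incr F" and ?E = "put_on_top d a b (oper_type F) E"
  have N: "nonloops ?D (oper_fun F d S) = {..<?D} - {a, b}"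
    unfolding F nonloops_def loops_dicut ..
  have st: "starts (oper_fun F d S) x y \<longleftrightarrow> ?E x y" if "x \<in> {..<?D} - {a, b}" "y \<in> {..<?D} - {a, b}" for x y
    unfolding F by (rule starts_dicut[OF profile_put_on_top[OF P]]) (use that in auto)
  have ab: "a < d" "b < d" using profileD[OF P] by auto
  have pos: "d < ?D" by (cases F) auto
  show ?thesis
  proof (intro equalityI subsetI)
    fix x assume x: "x \<in> top_digits ?D (oper_fun F d S)"
    then have xN: "x \<in> {..<?D} - {a, b}" unfolding top_digits_def N by simp
    have dN: "d \<in> {..<?D} - {a, b}" using ab pos by auto
    have "d \<noteq> x \<longrightarrow> ?E d x \<longrightarrow> ?E x d"
      using x dN st[OF dN xN] st[OF xN dN] unfolding top_digits_def N by blast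
    then have "\<not> x < d" using xN ab by (auto simp: put_on_top_def)
    then show "x \<in> {d..<?D}" using xN by auto
  next
    fix x assume x: "x \<in> {d..<?D}"
    then have xN: "x \<in> {..<?D} - {a, b}" using ab by auto
    have "?E y x \<longrightarrow> ?E x y" if "y \<in> {..<?D} - {a, b}" "y \<noteq> x" for y
      using that x by (auto simp: put_on_top_def)
    then show "x \<in> top_digits ?D (oper_fun F d S)"
      unfolding top_digits_def N using xN by (simp add: st)
  qed
qed

lemma permutes_mono: "p permutes {..<d} \<Longrightarrow> p permutes {..<d + (n :: nat)}"
  by (rule permutes_subset) auto

text \<open>
  The new relation depends on the old digits only through the old relation and the loops, and a
  permutation of the old digits fixes the new ones.
\<close>

lemma oper_fun_act:
  assumes "d \<ge> 1" "S \<in> MIS d" and p: "p permutes {..<d}"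
  shows "oper_fun F d (act p S) = act p (oper_fun F d S)"
proof -
  obtain a b E where P: "profile d a b E" and S: "S = dicut d a b E"
    and F: "oper_fun F d S = dicut (d + oper_incr F) a b (put_on_top d a b (oper_type F) E)"
    using oper_fun_cases[OF assms(1,2)] .
  have eq: "pinv p x = c \<longleftrightarrow> x = p c" for x c
    using permutes_inverses[OF p] by metis
  have eq2: "pinv p x = pinv p y \<longleftrightarrow> x = y" for x y
    using permutes_inverses[OF p] by metis
  have "oper_fun F d (act p S)
      = dicut (d + oper_incr F) (p a) (p b) (put_on_top d (p a) (p b) (oper_type F) (\<lambda>x y. E (pinv p x) (pinv p y)))"
    unfolding S act_dicut[OF p] by (rule oper_fun_dicut[OF profile_act[OF p P]])
  also have "\<dots> = dicut (d + oper_incr F) (p a) (p b) (\<lambda>x y. put_on_top d a b (oper_type F) E (pinv p x) (pinv p y))"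
    by (rule dicut_cong) (simp add: put_on_top_def permutes_inv_less[OF p] eq eq2 permutes_inverses[OF p])
  also have "\<dots> = act p (oper_fun F d S)"
    unfolding F by (rule act_dicut[symmetric, OF permutes_mono[OF p]])
  finally show ?thesis .
qed

lemma act_swap_oper_fun:
  assumes "d \<ge> 1" "S \<in> MIS d" and F2: "oper_incr F = 2"
  shows "act (transpose d (d + 1)) (oper_fun F d S) = oper_fun F d S"
proof -
  let ?\<tau> = "transpose d (d + 1)"
  obtain a b E where P: "profile d a b E" and S: "S = dicut d a b E"
    and F: "oper_fun F d S = dicut (d + oper_incr F) a b (put_on_top d a b (oper_type F) E)"
    using oper_fun_cases[OF assms(1,2)] .
  have ab: "a < d" "b < d" using profileD[OF P] by auto
  have p: "?\<tau> permutes {..<d + oper_incr F}"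
    by (rule permutes_swap_id) (auto simp: F2)
  have tau_ab: "?\<tau> a = a" "?\<tau> b = b" using ab by (auto simp: transpose_def)
  have "act ?\<tau> (oper_fun F d S) = dicut (d + oper_incr F) a b
      (\<lambda>x y. put_on_top d a b (oper_type F) E (?\<tau> x) (?\<tau> y))"
    unfolding F act_dicut[OF p] tau_ab by (simp add: inv_swap_id)
  also have "\<dots> = dicut (d + oper_incr F) a b (put_on_top d a b (oper_type F) E)"
    by (rule dicut_cong) (auto simp: transpose_def put_on_top_def)
  finally show ?thesis unfolding F .
qed

lemma act_restrict:
  assumes p: "p permutes {..<d}"
  shows "act p S \<inter> nodes d = act p (S \<inter> nodes d)"
  by (rule node_set_eqI) (simp add: mem_act[OF p] nodes_def permutes_inv_less[OF p])

lemma oper_eq_if_incr_type_eq: "oper_incr F = oper_incr F' \<Longrightarrow> oper_type F = oper_type F' \<Longrightarrow> F = F'"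
  by (cases F; cases F') auto

text \<open>
  The last operator can be read off an orbit. A permutation maps the top block to the top block,
  so the blocks have the same size; whether a top digit beats itself tells \<open>f\<close> from \<open>f'\<close> and \<open>g\<close>
  from \<open>g'\<close>. Up to exchanging the two digits of the top block, the permutation then fixes the new
  digits, and intersecting with the old words gives back the sets to which the operators were
  applied.
\<close>

theorem oper_fun_unique:
  assumes d: "d \<ge> 1" "S \<in> MIS d" and d': "d' \<ge> 1" "S' \<in> MIS d'"
    and D: "d + oper_incr F = d' + oper_incr F'"
    and p: "p permutes {..<d + oper_incr F}"
    and eq: "act p (oper_fun F d S) = oper_fun F' d' S'"
  shows "F = F'" "d = d'"
    "\<exists>q. q permutes {..<d} \<and> act q S = S' \<and> (p = q \<or> oper_incr F = 2 \<and> p = q \<circ> transpose d (d + 1))"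
proof -
  let ?D = "d + oper_incr F" and ?T = "oper_fun F d S" and ?\<tau> = "transpose d (d + 1)"
  have im: "p ` {d..<?D} = {d'..<?D}"
    using top_digits_act[OF p, of ?T] top_digits_oper_fun[OF d, of F] top_digits_oper_fun[OF d', of F'] eq D by simp
  have "card (p ` {d..<?D}) = card {d..<?D}"
    by (rule card_image) (rule permutes_inj_on[OF p])
  then have incr: "oper_incr F = oper_incr F'" using im D by simp
  then show dd: "d = d'" using D by simp
  have pos: "oper_incr F \<ge> 1" by (cases F) auto
  then have pd: "p d \<in> {d..<?D}" using im dd by auto
  have "starts (act p ?T) (p d) (p d) \<longleftrightarrow> starts ?T d d"
    by (simp add: starts_act[OF p] permutes_inverses[OF p])
  moreover have "starts ?T d d \<longleftrightarrow> \<not> oper_type F"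
    using starts_oper_fun[OF d, of d F] pos by simp
  moreover have "starts (act p ?T) (p d) (p d) \<longleftrightarrow> \<not> oper_type F'"
    unfolding eq using starts_oper_fun[OF d', of "p d" F'] pd D dd by simp
  ultimately show FF: "F = F'" using oper_eq_if_incr_type_eq[OF incr] by blast
  \<comment> \<open>a permutation fixing the new digits can be restricted to the old ones\<close>
  have main: "act q S = S' \<and> q permutes {..<d}"
    if q: "q permutes {..<?D}" "act q ?T = oper_fun F' d' S'" "\<And>x. x \<in> {..<?D} - {..<d} \<Longrightarrow> q x = x" for q
  proof -
    have qd: "q permutes {..<d}"
      by (rule permutes_superset[OF q(1)]) (use q(3) in blast)
    have "S' = act q ?T \<inter> nodes d" using oper_fun_restrict[OF d'] q(2) dd by metis
    also have "\<dots> = act q S" unfolding act_restrict[OF qd] oper_fun_restrict[OF d] ..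
    finally show ?thesis using qd by simp
  qed
  have inj: "p x = p y \<longleftrightarrow> x = y" for x y using permutes_inj[OF p] by (rule inj_eq)
  consider "oper_incr F = 1" | "oper_incr F = 2" by (cases F) auto
  then show "\<exists>q. q permutes {..<d} \<and> act q S = S' \<and> (p = q \<or> oper_incr F = 2 \<and> p = q \<circ> ?\<tau>)"
  proof cases
    case 1
    then have "p d = d" using pd by simp
    have "p x = x" if "x \<in> {..<?D} - {..<d}" for x
    proof -
      have "x = d" using that 1 by auto
      then show ?thesis using \<open>p d = d\<close> by simp
    qed
    then show ?thesis using main[OF p eq] by metis
  next
    case 2
    have "p (d + 1) \<in> {d..<?D}" using im dd 2 by auto
    then have p1: "p (d + 1) = d \<or> p (d + 1) = d + 1" using 2 by auto
    have p0: "p d = d \<or> p d = d + 1" using 2 pd by auto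
    have two: "x = d \<or> x = d + 1" if "x \<in> {..<?D} - {..<d}" for x
      using that 2 by auto
    show ?thesis
    proof (cases "p d = d")
      case True
      then have "p (d + 1) = d + 1" using p1 inj[of "d + 1" d] by auto
      then have "p x = x" if "x \<in> {..<?D} - {..<d}" for x
        using two[OF that] True by auto
      then show ?thesis using main[OF p eq] by metis
    next
      case False
      then have pd1: "p d = d + 1" using p0 by simp
      then have pd2: "p (d + 1) = d" using p1 inj[of "d + 1" d] by auto
      have \<tau>: "?\<tau> permutes {..<?D}" by (rule permutes_swap_id) (auto simp: 2)
      let ?q = "p \<circ> ?\<tau>"
      have "?q permutes {..<?D}" by (rule permutes_compose[OF \<tau> p])
      moreover have "act ?q ?T = oper_fun F' d' S'"
        unfolding act_comp[symmetric] act_swap_oper_fun[OF d 2] by (rule eq)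
      moreover have "?q x = x" if "x \<in> {..<?D} - {..<d}" for x
        using two[OF that] pd1 pd2 by auto
      ultimately have "act ?q S = S' \<and> ?q permutes {..<d}" by (rule main)
      moreover have "p = ?q \<circ> ?\<tau>" by (simp add: comp_assoc)
      ultimately show ?thesis using 2 by metis
    qed
  qed
qed

text \<open>
  Combine a bijection from \<open>A\<close> to \<open>B\<close> with one between their complements in \<open>D\<close>.
\<close>

lemma ex_permutes_image:
  fixes A B D :: "nat set"
  assumes "finite D" "A \<subseteq> D" "B \<subseteq> D" "card A = card B"
  obtains p where "p permutes D" "p ` A = B"
proof -
  have fin: "finite A" "finite B" using assms finite_subset by auto
  obtain f where f: "bij_betw f A B"
    using finite_same_card_bij[OF fin assms(4)] by blast
  have "card (D - A) = card (D - B)" using assms fin by (simp add: card_Diff_subset)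
  then obtain g where g: "bij_betw g (D - A) (D - B)"
    using finite_same_card_bij[of "D - A" "D - B"] assms(1) by blast
  let ?p = "\<lambda>x. if x \<in> A then f x else if x \<in> D then g x else x"
  have 1: "bij_betw ?p A B" using f by (rule bij_betw_cong[THEN iffD1, rotated]) simp
  have 2: "bij_betw ?p (D - A) (D - B)" using g by (rule bij_betw_cong[THEN iffD1, rotated]) simp
  have "bij_betw ?p (A \<union> (D - A)) (B \<union> (D - B))"
    by (rule bij_betw_combine[OF 1 2]) blast
  moreover have "A \<union> (D - A) = D" "B \<union> (D - B) = D" using assms by auto
  ultimately have "?p permutes D"
    by (intro bij_imp_permutes) (use assms(2) in auto)
  moreover have "?p ` A = B" using 1 by (simp add: bij_betw_def)
  ultimately show thesis by (rule that)
qed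

text \<open>
  The shape of a profile on the set \<open>N\<close> of its non-loop digits. The set \<open>T\<close> consists of the digits
  that are not strictly beaten. It has one or two elements, which are interchangeable, and beats
  all the other digits; iterating this shows that a profile is a linear order of blocks of size at
  most two.
\<close>

context
  fixes d a b :: nat and E :: "nat \<Rightarrow> nat \<Rightarrow> bool" and N T :: "nat set"
  assumes P: "profile d a b E"
  defines "N \<equiv> {..<d} - {a, b}"
  defines "T \<equiv> {x \<in> N. \<forall>y \<in> N. y \<noteq> x \<longrightarrow> E y x \<longrightarrow> E x y}"
begin

lemma no_constant_triangle:
  assumes "x \<in> N" "y \<in> N" "z \<in> N" "\<not> (x = y \<and> y = z)"
  shows "\<not> (E x y = E y z \<and> E y z = E z x)"
  using profileD(7)[OF P, of x y z] assms unfolding N_def by blast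

lemma beats_trans:
  assumes "x \<in> N" "y \<in> N" "z \<in> N" "E x y" "\<not> E y x" "E y z" "\<not> E z y"
  shows "E x z" "\<not> E z x"
proof -
  have "x \<noteq> y" using assms by metis
  then show "\<not> E z x" "E x z"
    using no_constant_triangle[of x y z] no_constant_triangle[of x z y] assms by metis+
qed

lemma top_nonempty:
  assumes "N \<noteq> {}"
  shows "T \<noteq> {}"
proof -
  let ?R = "\<lambda>x y. E x y \<and> \<not> E y x"
  have "asymp_on N ?R" by (rule asymp_onI) simp
  moreover have "transp_on N ?R" by (rule transp_onI) (use beats_trans in metis)
  moreover have "finite N" unfolding N_def by simp
  ultimately obtain m where "m \<in> N" "\<forall>x\<in>N. x \<noteq> m \<longrightarrow> \<not> ?R x m"
    using Finite_Set.bex_min_element[of N ?R] assms by metis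
  then have "m \<in> T" unfolding T_def by blast
  then show ?thesis by blast
qed

text \<open>
  The closed walks \<open>xxy\<close> and \<open>yyx\<close> force a pair of digits that beat each other equally to differ
  from both of their self-comparisons.
\<close>

lemma top_pair:
  assumes "x \<in> T" "y \<in> T" "x \<noteq> y"
  shows "E x y = (\<not> E x x)" "E y x = (\<not> E x x)" "E y y = E x x"
proof -
  have *: "x \<in> N" "y \<in> N" "E x y = E y x" using assms unfolding T_def by auto
  show "E x y = (\<not> E x x)" "E y x = (\<not> E x x)" "E y y = E x x"
    using no_constant_triangle[of x x y] no_constant_triangle[of y y x] * assms(3) by metis+
qed

text \<open>
  Some \<open>y\<close> strictly beats \<open>z\<close>. If \<open>x\<close> did not strictly beat \<open>z\<close>, then \<open>x\<close> would be tied with \<open>z\<close>,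
  and by transitivity with \<open>y\<close> too; the two ties have the same bit, namely the opposite of
  \<open>E x x\<close>, so either \<open>xyz\<close> or \<open>xzy\<close> is a constant closed walk.
\<close>

lemma top_beats:
  assumes x: "x \<in> T" and z: "z \<in> N" "z \<notin> T"
  shows "E x z" "\<not> E z x"
proof -
  obtain y where y: "y \<in> N" "y \<noteq> z" "E y z" "\<not> E z y" using z unfolding T_def by blast
  have xN: "x \<in> N" and xT: "\<And>u. u \<in> N \<Longrightarrow> u \<noteq> x \<Longrightarrow> E u x \<Longrightarrow> E x u" using x unfolding T_def by auto
  have "E x z \<and> \<not> E z x"
  proof (rule ccontr)
    assume n: "\<not> (E x z \<and> \<not> E z x)"
    have xz: "x \<noteq> z" using x z by auto
    have e: "E x z = E z x" using n xT[of z] z xz by metis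
    have xy: "x \<noteq> y" using e y by metis
    have "\<not> (E x y \<and> \<not> E y x)" using beats_trans[of x y z] xN y z e by metis
    then have e': "E x y = E y x" using xT[of y] y xy by metis
    show False
      using no_constant_triangle[of x x z] no_constant_triangle[of x x y] no_constant_triangle[of x y z] no_constant_triangle[of x z y] e e' xN y z xz xy by metis
  qed
  then show "E x z" "\<not> E z x" by auto
qed

text \<open>
  Three digits tied pairwise would all be tied with the same bit.
\<close>

lemma card_top_le: "card T \<le> 2"
proof (rule ccontr)
  assume "\<not> card T \<le> 2"
  then have "card T \<ge> 3" by simp
  then obtain U where U: "U \<subseteq> T" "card U = 3" using obtain_subset_with_card_n by metis
  then obtain x y z where "U = {x, y, z}" "x \<noteq> y" "y \<noteq> z" "x \<noteq> z" using card_3_iff by metis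
  then have xyz: "x \<in> T" "y \<in> T" "z \<in> T" "x \<noteq> y" "y \<noteq> z" "x \<noteq> z" using U by auto
  have "x \<in> N" "y \<in> N" "z \<in> N" using xyz unfolding T_def by auto
  then show False
    using no_constant_triangle[of x y z] top_pair[of x y] top_pair[of y z] top_pair[of z x] xyz by metis
qed

end

lemma profile_restrict:
  assumes P: "profile d a b E" and "a < d'" "b < d'" "d' \<le> d"
  shows "profile d' a b E"
  unfolding profile_def
proof (intro conjI allI impI, goal_cases)
  case (7 x y z)
  then show ?case using profileD(7)[OF P, of x y z] assms(4) by simp
qed (use assms profileD[OF P] in auto)

text \<open>
  The top block is moved to the largest digits. What remains below it is again a maximum
  independent set, and the operator is chosen according to the size of the block and to whether
  its digits beat themselves.
\<close>

theorem MIS_decompose: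
  assumes d: "d \<ge> 1" and S: "S \<in> MIS d" and N: "nonloops d S \<noteq> {}"
  obtains F d' S' p where "d' \<ge> 1" "S' \<in> MIS d'" "d = d' + oper_incr F" "p permutes {..<d}"
    "act p S = oper_fun F d' S'"
proof -
  obtain a b where P: "profile d a b (starts S)" and S_eq: "S = dicut d a b (starts S)"
    using MIS_is_dicut[OF d S] .
  define E where "E = starts S"
  note P = P[folded E_def] and S_eq = S_eq[folded E_def]
  let ?N = "{..<d} - {a, b}"
  \<comment> \<open>the top block\<close>
  define T where "T = {x \<in> ?N. \<forall>y \<in> ?N. y \<noteq> x \<longrightarrow> E y x \<longrightarrow> E x y}"
  have N': "?N \<noteq> {}" using N S_eq loops_dicut unfolding nonloops_def by metis
  have Tne: "T \<noteq> {}" unfolding T_def by (rule top_nonempty[OF P N'])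
  have Tle: "card T \<le> 2" unfolding T_def by (rule card_top_le[OF P])
  have pair: "E x y = (\<not> E x x)" "E y y = E x x" if "x \<in> T" "y \<in> T" "x \<noteq> y" for x y
    using top_pair[OF P, of x y] that unfolding T_def by blast+
  have beats: "E x z" "\<not> E z x" if "x \<in> T" "z \<in> ?N" "z \<notin> T" for x z
    using top_beats[OF P, of x z] that unfolding T_def by blast+
  have TN: "T \<subseteq> ?N" unfolding T_def by blast
  have finT: "finite T" using TN finite_subset by blast
  obtain m where m: "m \<in> T" using Tne by blast
  have "card T \<noteq> 0" using Tne finT by simp
  then have "card T = 1 \<or> card T = 2" using Tle by linarith
  then obtain F where F: "oper_incr F = card T" "oper_type F = (\<not> E m m)"
    using oper_incr.simps oper_type.simps by metis
  have Emm: "E x x = E m m" if "x \<in> T" for x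
    using pair(2)[OF m that] by metis
  have "card T \<le> card {..<d}" using TN by (intro card_mono) auto
  then have cT: "card T \<le> d" by simp
  define d' where "d' = d - card T"
  have dd: "d = d' + oper_incr F" "d' \<le> d" unfolding d'_def F(1) using cT by auto
  obtain p where p: "p permutes {..<d}" and pT: "p ` T = {d'..<d}"
  proof (rule ex_permutes_image[of "{..<d}" T "{d'..<d}"])
    show "card T = card {d'..<d}" using dd F by simp
  qed (use TN in auto)
  have inT: "pinv p x \<in> T \<longleftrightarrow> \<not> x < d'" if "x < d" for x
  proof -
    have "pinv p x \<in> T \<longleftrightarrow> p (pinv p x) \<in> p ` T" by (simp add: inj_image_mem_iff[OF permutes_inj[OF p]])
    then show ?thesis using that by (simp add: pT permutes_inverses[OF p] not_less)
  qed
  have inN: "pinv p x \<in> ?N \<longleftrightarrow> x < d \<and> x \<notin> {p a, p b}" for x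
  proof -
    have eq: "pinv p x = c \<longleftrightarrow> x = p c" for x c using permutes_inverses[OF p] by metis
    show ?thesis by (simp add: permutes_inv_less[OF p] eq)
  qed
  \<comment> \<open>after renaming the digits, the top block is \<open>{d'..<d}\<close>\<close>
  let ?E = "\<lambda>x y. E (pinv p x) (pinv p y)"
  have P': "profile d (p a) (p b) ?E" by (rule profile_act[OF p P])
  note pr = profileD[OF P']
  have "p a < d'" "p b < d'"
    using inT[of "p a"] inT[of "p b"] pr(1,2) TN by (auto simp: permutes_inverses[OF p])
  then have Q: "profile d' (p a) (p b) ?E" using profile_restrict[OF P'] dd by blast
  let ?S = "dicut d' (p a) (p b) ?E"
  have "oper_fun F d' ?S = dicut d (p a) (p b) (put_on_top d' (p a) (p b) (oper_type F) ?E)"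
    unfolding oper_fun_dicut[OF Q] dd(1)[symmetric] ..
  also have "\<dots> = dicut d (p a) (p b) ?E"
  proof (rule dicut_cong)
    fix x y assume xy: "x < d" "y < d" "\<not> (x = y \<and> x \<in> {p a, p b})"
    have t: "\<not> x < d' \<Longrightarrow> pinv p x \<in> T" "\<not> y < d' \<Longrightarrow> pinv p y \<in> T" using inT xy by blast+
    have l: "?E l u \<and> \<not> ?E u l" if "l \<in> {p a, p b}" "\<not> u < d'" "u < d" for l u
    proof -
      have "u \<noteq> p a" "u \<noteq> p b" using \<open>p a < d'\<close> \<open>p b < d'\<close> that by auto
      then show ?thesis using that pr(3-6)[of u] by auto
    qed
    have n: "?E u v \<and> \<not> ?E v u" if "v < d'" "v \<notin> {p a, p b}" "\<not> u < d'" "u < d" for u v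
      using beats[of "pinv p u" "pinv p v"] inT[of u] inT[of v] inN[of v] that dd by auto
    have inj: "pinv p x \<noteq> pinv p y" if "x \<noteq> y"
      using that permutes_inverses(1)[OF p] by metis
    consider "x < d'" "y < d'" | "x < d'" "\<not> y < d'" | "\<not> x < d'" "y < d'"
      | "\<not> x < d'" "\<not> y < d'" "x = y" | "\<not> x < d'" "\<not> y < d'" "x \<noteq> y" by metis
    then show "put_on_top d' (p a) (p b) (oper_type F) ?E x y = ?E x y"
    proof cases
      case 1 then show ?thesis by (simp add: put_on_top_def)
    next
      case 2 then show ?thesis using l[of x y] n[of x y] xy unfolding put_on_top_def by metis
    next
      case 3 then show ?thesis using l[of y x] n[of y x] xy unfolding put_on_top_def by metis
    next
      case 4 then show ?thesis using Emm[OF t(1)] F(2) by (simp add: put_on_top_def)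
    next
      case 5
      then show ?thesis using Emm[OF t(1)] F(2) pair(1)[OF t(1) t(2) inj] by (simp add: put_on_top_def)
    qed
  qed
  also have "\<dots> = act p S"
    by (subst S_eq) (rule act_dicut[OF p, symmetric])
  finally have "act p S = oper_fun F d' ?S" ..
  moreover have "d' \<ge> 1" using \<open>p a < d'\<close> by simp
  moreover have "?S \<in> MIS d'" by (rule dicut_in_MIS[OF Q])
  ultimately show thesis using that dd(1) p by blast
qed

section \<open>Orbits and stabilizers\<close>

lemma perm_group_simps [simp]:
  "carrier (perm_group d) = {p. p permutes {..<d}}" "x \<otimes>\<^bsub>perm_group d\<^esub> y = x \<circ> y"
  "\<one>\<^bsub>perm_group d\<^esub> = id"
  by (simp_all add: perm_group_def)

lemma perm_group_is_group: "group (perm_group d)"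
proof (rule groupI)
  fix p assume "p \<in> carrier (perm_group d)"
  then have p: "p permutes {..<d}" by simp
  show "\<exists>q\<in>carrier (perm_group d). q \<otimes>\<^bsub>perm_group d\<^esub> p = \<one>\<^bsub>perm_group d\<^esub>"
    by (rule bexI[of _ "pinv p"]) (simp_all add: permutes_inv_o[OF p] permutes_inv[OF p])
qed (auto simp: permutes_compose permutes_id comp_assoc)

lemma order_perm_group: "order (perm_group d) = fact d"
  unfolding order_def by (simp add: card_permutations)

abbreviation orb :: "nat \<Rightarrow> node set \<Rightarrow> node set set" where
  "orb d \<equiv> orbit (perm_group d) act"

lemma mem_orb: "T \<in> orb d S \<longleftrightarrow> (\<exists>p. p permutes {..<d} \<and> T = act p S)"
  unfolding orbit_def by auto

lemma orb_refl: "S \<in> orb d S"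
  unfolding mem_orb using permutes_id[of "{..<d}"] act_id by metis

lemma orb_sym: "T \<in> orb d S \<Longrightarrow> S \<in> orb d T"
  unfolding mem_orb using permutes_inv act_inv(1) by metis

lemma orb_trans: "T \<in> orb d S \<Longrightarrow> U \<in> orb d T \<Longrightarrow> U \<in> orb d S"
  unfolding mem_orb using permutes_compose act_comp by metis

lemma orb_eq: "T \<in> orb d S \<Longrightarrow> orb d T = orb d S"
  using orb_sym orb_trans by blast

lemma orb_act: "p permutes {..<d} \<Longrightarrow> orb d (act p S) = orb d S"
  by (rule orb_eq) (auto simp: mem_orb)

lemma orb_MIS: "d \<ge> 1 \<Longrightarrow> S \<in> MIS d \<Longrightarrow> T \<in> orb d S \<Longrightarrow> T \<in> MIS d"
  unfolding mem_orb using act_MIS by blast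

lemma mem_MIS_orbits: "C \<in> MIS_orbits d \<longleftrightarrow> (\<exists>S\<in>MIS d. C = orb d S)"
  unfolding MIS_orbits_def orbits_def by blast

lemma mem_stab: "p \<in> stab d S \<longleftrightarrow> p permutes {..<d} \<and> act p S = S"
  unfolding stab_def stabilizer_def by simp

text \<open>
  The action is restricted to the set of MISs because group actions are by extensional functions.
\<close>

lemma MIS_action:
  assumes d: "d \<ge> 1"
  shows "group_action (perm_group d) (MIS d) (\<lambda>p. restrict (act p) (MIS d))"
proof -
  let ?\<phi> = "\<lambda>p. restrict (act p) (MIS d)"
  have "?\<phi> p \<in> carrier (BijGroup (MIS d))" if p: "p permutes {..<d}" for p
  proof -
    have "bij_betw (act p) (MIS d) (MIS d)"
      by (rule bij_betwI[of _ _ _ "act (pinv p)"])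
         (use act_MIS[OF d _ p] act_MIS[OF d _ permutes_inv[OF p]] act_inv[OF p] in auto)
    then show ?thesis
      unfolding BijGroup_def Bij_def by (simp cong: bij_betw_cong)
  qed
  moreover have "?\<phi> (p \<circ> q) = ?\<phi> p \<otimes>\<^bsub>BijGroup (MIS d)\<^esub> ?\<phi> q"
    if p: "p permutes {..<d}" "q permutes {..<d}"
      and B: "?\<phi> p \<in> carrier (BijGroup (MIS d))" "?\<phi> q \<in> carrier (BijGroup (MIS d))" for p q
    using B act_MIS[OF d _ p(2)] unfolding BijGroup_def
    by (auto simp: compose_def act_comp restrict_def fun_eq_iff)
  ultimately have "?\<phi> \<in> hom (perm_group d) (BijGroup (MIS d))"
    unfolding hom_def by auto
  then show ?thesis
    unfolding group_action_def group_hom_def group_hom_axioms_def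
    using perm_group_is_group group_BijGroup by blast
qed

lemma orbit_stabilizer:
  assumes d: "d \<ge> 1" and S: "S \<in> MIS d"
  shows "card (orb d S) * card (stab d S) = fact d"
proof -
  interpret group_action "perm_group d" "MIS d" "\<lambda>p. restrict (act p) (MIS d)"
    by (rule MIS_action[OF d])
  have "orb d S = orbit (perm_group d) (\<lambda>p. restrict (act p) (MIS d)) S"
    unfolding orbit_def using S by simp
  moreover have "stab d S = stabilizer (perm_group d) (\<lambda>p. restrict (act p) (MIS d)) S"
    unfolding stab_def stabilizer_def using S by simp
  ultimately show ?thesis
    using orbit_stabilizer_theorem[OF S] order_perm_group by simp
qed

lemma stab_subgroup:
  assumes d: "d \<ge> 1" and S: "S \<in> MIS d"
  shows "subgroup (stab d S) (perm_group d)"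
proof -
  interpret group_action "perm_group d" "MIS d" "\<lambda>p. restrict (act p) (MIS d)"
    by (rule MIS_action[OF d])
  have "stab d S = stabilizer (perm_group d) (\<lambda>p. restrict (act p) (MIS d)) S"
    unfolding stab_def stabilizer_def using S by simp
  then show ?thesis using stabilizer_subgroup[OF S] by simp
qed

lemma card_stab_orb:
  assumes d: "d \<ge> 1" and S: "S \<in> MIS d" and T: "T \<in> orb d S"
  shows "card (stab d T) = card (stab d S)"
proof -
  have "card (orb d S) * card (stab d T) = card (orb d S) * card (stab d S)"
    using orbit_stabilizer[OF d S] orbit_stabilizer[OF d orb_MIS[OF d S T]] orb_eq[OF T] by simp
  moreover have "card (orb d S) \<noteq> 0"
    using orbit_stabilizer[OF d S] by (metis fact_nonzero mult_eq_0_iff)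
  ultimately show ?thesis by simp
qed

section \<open>Operators on orbits\<close>

definition ext_orbit :: "oper \<Rightarrow> nat \<Rightarrow> node set set \<Rightarrow> node set set" where
  "ext_orbit F d C = (\<Union>S\<in>C. orb (d + oper_incr F) (oper_fun F d S))"

lemma apply_oper_eq: "apply_oper F (d, C) = (d + oper_incr F, ext_orbit F d C)"
  by (simp add: ext_orbit_def)

text \<open>
  By compatibility with the actions, all representatives of an orbit lead to the same orbit.
\<close>

lemma ext_orbit_orb:
  assumes d: "d \<ge> 1" and S: "S \<in> MIS d"
  shows "ext_orbit F d (orb d S) = orb (d + oper_incr F) (oper_fun F d S)"
proof -
  have "orb (d + oper_incr F) (oper_fun F d T) = orb (d + oper_incr F) (oper_fun F d S)" if "T \<in> orb d S" for T
  proof -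
    obtain p where p: "p permutes {..<d}" "T = act p S" using \<open>T \<in> orb d S\<close> unfolding mem_orb by blast
    show ?thesis unfolding p(2) oper_fun_act[OF d S p(1)] by (rule orb_act[OF permutes_mono[OF p(1)]])
  qed
  then have "ext_orbit F d (orb d S) = (\<Union>T\<in>orb d S. orb (d + oper_incr F) (oper_fun F d S))"
    unfolding ext_orbit_def by (rule SUP_cong[OF refl])
  also have "\<dots> = orb (d + oper_incr F) (oper_fun F d S)"
    using orb_refl[of S d] by auto
  finally show ?thesis .
qed

lemma ext_orbit_in_MIS_orbits:
  assumes d: "d \<ge> 1" and C: "C \<in> MIS_orbits d"
  shows "ext_orbit F d C \<in> MIS_orbits (d + oper_incr F)"
proof -
  obtain S where S: "S \<in> MIS d" "C = orb d S" using C mem_MIS_orbits by blast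
  show ?thesis
    unfolding S(2) ext_orbit_orb[OF d S(1)] mem_MIS_orbits using oper_fun_MIS[OF d S(1)] by blast
qed

theorem ext_orbit_unique:
  assumes d: "d \<ge> 1" "C \<in> MIS_orbits d" and d': "d' \<ge> 1" "C' \<in> MIS_orbits d'"
    and D: "d + oper_incr F = d' + oper_incr F'"
    and eq: "ext_orbit F d C = ext_orbit F' d' C'"
  shows "F = F' \<and> d = d' \<and> C = C'"
proof -
  obtain S where S: "S \<in> MIS d" "C = orb d S" using d(2) mem_MIS_orbits by blast
  obtain S' where S': "S' \<in> MIS d'" "C' = orb d' S'" using d'(2) mem_MIS_orbits by blast
  have "orb (d + oper_incr F) (oper_fun F d S) = orb (d' + oper_incr F') (oper_fun F' d' S')"
    using eq unfolding S(2) S'(2) ext_orbit_orb[OF d(1) S(1)] ext_orbit_orb[OF d'(1) S'(1)] .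
  then have "oper_fun F' d' S' \<in> orb (d + oper_incr F) (oper_fun F d S)"
    by (simp only: orb_refl)
  then obtain p where p: "p permutes {..<d + oper_incr F}" "act p (oper_fun F d S) = oper_fun F' d' S'"
    unfolding mem_orb by metis
  note u = oper_fun_unique[OF d(1) S(1) d'(1) S'(1) D p]
  obtain q where "q permutes {..<d}" "act q S = S'" using u(3) by blast
  then have "S' \<in> orb d S" unfolding mem_orb by blast
  then have "orb d S' = orb d S" by (rule orb_eq)
  then show ?thesis using u(1,2) S(2) S'(2) by simp
qed

text \<open>
  Both starting sets are cuts of the usual order: for \<open>d = 1\<close> the two loops coincide, and for
  \<open>d = 2\<close> they are \<open>0\<close> and \<open>1\<close>.
\<close>

abbreviation (input) start_set :: "nat \<Rightarrow> node set" where
  "start_set d \<equiv> dicut d 0 (d - 1) (<)"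

lemma start_orbits_alt: "start_orbits = {(1, orb 1 (start_set 1)), (2, orb 2 (start_set 2))}"
proof -
  have "start_set 1 = {(0, 0, 0)}"
    by (rule node_set_eqI) (auto simp: mem_dicut)
  moreover have "start_set 2 = {(0, 0, 0), (0, 1, 0), (1, 1, 1)}"
    by (rule node_set_eqI) (auto simp: mem_dicut less_2_cases_iff)
  ultimately show ?thesis unfolding start_orbits_def by simp
qed

lemma start_profile:
  assumes "d = 1 \<or> d = 2"
  shows "profile d 0 (d - 1) (<)" "{..<d} = {0, d - 1}"
  using assms by (auto simp: profile_def)

lemma start_orbit_MIS:
  assumes "(d, C) \<in> start_orbits"
  shows "d \<ge> 1" "C \<in> MIS_orbits d" "S \<in> C \<Longrightarrow> nonloops d S = {}"
proof -
  have d: "d = 1 \<or> d = 2" and C: "C = orb d (start_set d)" using assms unfolding start_orbits_alt by auto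
  show "d \<ge> 1" using d by auto
  show "C \<in> MIS_orbits d"
    unfolding C mem_MIS_orbits using dicut_in_MIS[OF start_profile(1)[OF d]] by blast
  assume "S \<in> C"
  then obtain p where p: "p permutes {..<d}" "S = act p (start_set d)" unfolding C mem_orb by blast
  have "nonloops d (start_set d) = {}"
    unfolding nonloops_def loops_dicut start_profile(2)[OF d] by simp
  then show "nonloops d S = {}" unfolding p(2) nonloops_act[OF p(1)] by simp
qed

text \<open>
  A set all of whose digits are loops has at most two digits and is the starting set up to
  renaming the distinguished loop to \<open>0\<close>. A permutation stabilizing it fixes the distinguished
  loop and hence the other one.
\<close>

lemma no_nonloops_start:
  assumes d: "d \<ge> 1" and S: "S \<in> MIS d" and N: "nonloops d S = {}"
  shows "(d, orb d S) \<in> start_orbits" "stab d S = {id}"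
proof -
  obtain a b where P: "profile d a b (starts S)" and S_eq: "S = dicut d a b (starts S)"
    using MIS_is_dicut[OF d S] .
  note pr = profileD[OF P]
  have L: "loops S = {a, b}" using S_eq loops_dicut by metis
  then have dab: "{..<d} = {a, b}" using N pr(1,2) unfolding nonloops_def by auto
  have cd: "d = 1 \<and> a = b \<or> d = 2 \<and> a \<noteq> b"
  proof -
    have "d = card {a, b}" using dab by (metis card_lessThan)
    then show ?thesis by (cases "a = b") auto
  qed
  then have d12: "d = 1 \<or> d = 2" by blast
  have ab: "a = 0 \<and> b = d - 1 \<or> a = 1 \<and> b = 0 \<and> d = 2" using cd pr(1,2) by auto
  let ?p = "transpose 0 a :: nat \<Rightarrow> nat"
  have p: "?p permutes {..<d}" by (rule permutes_swap_id) (use pr(1) d in auto)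
  have pab: "?p 0 = a" "?p (d - 1) = b" using ab by auto
  have "act ?p (start_set d) = dicut d a b (\<lambda>x y. pinv ?p x < pinv ?p y)"
    unfolding act_dicut[OF p] pab ..
  also have "\<dots> = dicut d a b (starts S)"
  proof (rule dicut_cong)
    fix x y assume xy: "x < d" "y < d" "\<not> (x = y \<and> x \<in> {a, b})"
    then have "x \<in> {a, b}" "y \<in> {a, b}" using dab by auto
    then have "a \<noteq> b" "x = a \<and> y = b \<or> x = b \<and> y = a" using xy by auto
    have "pinv ?p a = 0" "pinv ?p b = d - 1"
      using permutes_inverses(2)[OF p] pab by metis+
    moreover have "d - 1 > 0" using cd \<open>a \<noteq> b\<close> by auto
    moreover have "starts S a b" "\<not> starts S b a"
      using pr(3)[OF pr(2)] pr(4)[OF pr(2)] \<open>a \<noteq> b\<close> by metis+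
    ultimately show "(pinv ?p x < pinv ?p y) = starts S x y"
      using \<open>x = a \<and> y = b \<or> x = b \<and> y = a\<close> by (elim disjE conjE) simp_all
  qed
  also have "\<dots> = S" by (rule S_eq[symmetric])
  finally have "S \<in> orb d (start_set d)" using p unfolding mem_orb by metis
  then have "orb d S = orb d (start_set d)" by (rule orb_eq)
  then show "(d, orb d S) \<in> start_orbits" unfolding start_orbits_alt using d12 by (elim disjE) simp_all
  have "p = id" if ps: "p \<in> stab d S" for p
  proof -
    have pd: "p permutes {..<d}" and pS: "act p S = S" using ps unfolding mem_stab by auto
    have "act p (dicut d a b (starts S)) = dicut d a b (starts S)"
      using pS unfolding S_eq[symmetric] .
    then have "dist_loop d (dicut d (p a) (p b) (\<lambda>x y. starts S (pinv p x) (pinv p y))) = a"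
      unfolding act_dicut[OF pd] by (simp only: dist_loop_dicut[OF P])
    then have pa: "p a = a"
      unfolding dist_loop_dicut[OF profile_act[OF pd P]] .
    have "{p a, p b} = {a, b}" using loops_act[OF pd, of S] pS L by simp
    then have pb: "p b = b" unfolding pa doubleton_eq_iff by blast
    have "p x = x" for x
    proof (cases "x < d")
      case True
      then have "x \<in> {a, b}" using dab by blast
      then show ?thesis using pa pb by auto
    qed (use permutes_not_in[OF pd] in simp)
    then show "p = id" by auto
  qed
  moreover have "id \<in> stab d S" unfolding mem_stab by (simp add: act_id permutes_id)
  ultimately show "stab d S = {id}" by blast
qed

lemma nonloops_oper_fun:
  assumes "d \<ge> 1" "S \<in> MIS d"
  shows "nonloops (d + oper_incr F) (oper_fun F d S) \<noteq> {}"
proof -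
  have "top_digits (d + oper_incr F) (oper_fun F d S) \<noteq> {}"
    unfolding top_digits_oper_fun[OF assms] by (cases F) auto
  then show ?thesis unfolding top_digits_def by auto
qed

lemma ext_orbit_not_start:
  assumes d: "d \<ge> 1" and C: "C \<in> MIS_orbits d"
  shows "(d + oper_incr F, ext_orbit F d C) \<notin> start_orbits"
proof
  assume st: "(d + oper_incr F, ext_orbit F d C) \<in> start_orbits"
  obtain S where S: "S \<in> MIS d" "C = orb d S" using C mem_MIS_orbits by blast
  have "oper_fun F d S \<in> ext_orbit F d C"
    unfolding S(2) ext_orbit_orb[OF d S(1)] by (rule orb_refl)
  then show False using start_orbit_MIS(3)[OF st] nonloops_oper_fun[OF d S(1)] by blast
qed

lemma MIS_orbits_cases:
  assumes d: "d \<ge> 1" and C: "C \<in> MIS_orbits d"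
  obtains "(d, C) \<in> start_orbits"
  | F d' C' where "d' \<ge> 1" "C' \<in> MIS_orbits d'" "d = d' + oper_incr F" "C = ext_orbit F d' C'"
proof -
  obtain S where S: "S \<in> MIS d" "C = orb d S" using C mem_MIS_orbits by blast
  show thesis
  proof (cases "nonloops d S = {}")
    case True
    then show thesis using that(1) no_nonloops_start(1)[OF d S(1)] S(2) by blast
  next
    case False
    obtain F d' S' p where *: "d' \<ge> 1" "S' \<in> MIS d'" "d = d' + oper_incr F" "p permutes {..<d}"
      "act p S = oper_fun F d' S'" using MIS_decompose[OF d S(1) False] .
    have "C = ext_orbit F d' (orb d' S')"
      unfolding S(2) ext_orbit_orb[OF *(1,2)] *(3)[symmetric] *(5)[symmetric] orb_act[OF *(4)] ..
    moreover have "orb d' S' \<in> MIS_orbits d'" using * mem_MIS_orbits by blast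
    ultimately show thesis using that(2) * by blast
  qed
qed

lemma fold_apply_oper_MIS:
  assumes "c \<in> start_orbits"
  shows "fst (fold apply_oper ops c) \<ge> 1 \<and> snd (fold apply_oper ops c) \<in> MIS_orbits (fst (fold apply_oper ops c))"
proof (induction ops rule: rev_induct)
  case Nil
  then show ?case using start_orbit_MIS[of "fst c" "snd c"] assms by simp
next
  case (snoc F ops)
  then show ?case
    using ext_orbit_in_MIS_orbits[of "fst (fold apply_oper ops c)" "snd (fold apply_oper ops c)" F]
    by (simp add: apply_oper_eq[of F "fst (fold apply_oper ops c)" "snd (fold apply_oper ops c)", simplified prod.collapse])
qed

text \<open>
  Induction on the number of digits: an orbit is either a starting orbit or of the form
  \<open>ext_orbit F d' C'\<close> with \<open>F\<close>, \<open>d'\<close> and \<open>C'\<close> determined by the orbit, and the two cases exclude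
  each other because starting sets have no digits other than loops.
\<close>

theorem unique_operator_word:
  assumes "d \<ge> 1" "C \<in> MIS_orbits d"
  shows "\<exists>!p. case p of (c, ops) \<Rightarrow> c \<in> start_orbits \<and> fold apply_oper ops c = (d, C)"
  using assms
proof (induction d arbitrary: C rule: less_induct)
  case (less d C)
  have last: "\<exists>d' C'. d' \<ge> 1 \<and> C' \<in> MIS_orbits d' \<and> fold apply_oper ops c = (d', C') \<and> d = d' + oper_incr F
       \<and> C = ext_orbit F d' C'"
    if "c \<in> start_orbits" "fold apply_oper (ops @ [F]) c = (d, C)" for c ops F
  proof -
    obtain d' C' where e: "fold apply_oper ops c = (d', C')" by (cases "fold apply_oper ops c")
    then have "d' \<ge> 1" "C' \<in> MIS_orbits d'" using fold_apply_oper_MIS[OF that(1), of ops] by auto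
    then show ?thesis using that(2) e apply_oper_eq by simp
  qed
  from less.prems show ?case
  proof (cases rule: MIS_orbits_cases)
    case 1
    show ?thesis
    proof (rule ex1I[of _ "((d, C), [])"])
      show "case ((d, C), []) of (c, ops) \<Rightarrow> c \<in> start_orbits \<and> fold apply_oper ops c = (d, C)"
        using 1 by simp
    next
      fix q assume q: "case q of (c, ops) \<Rightarrow> c \<in> start_orbits \<and> fold apply_oper ops c = (d, C)"
      obtain c ops where cq: "q = (c, ops)" by (cases q)
      have c: "c \<in> start_orbits" "fold apply_oper ops c = (d, C)" using q cq by auto
      show "q = ((d, C), [])"
      proof (cases ops rule: rev_cases)
        case Nil
        then show ?thesis using c cq by simp
      next
        case (snoc ops' F)
        obtain d' C' where "d' \<ge> 1" "C' \<in> MIS_orbits d'" "d = d' + oper_incr F" "C = ext_orbit F d' C'"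
          using last[OF c(1)] c(2) snoc by blast
        then show ?thesis using ext_orbit_not_start 1 by metis
      qed
    qed
  next
    case (2 F d' C')
    have "d' < d" using 2 by (cases F) auto
    from less.IH[OF this 2(1,2)] obtain r where
      r: "case r of (c, ops) \<Rightarrow> c \<in> start_orbits \<and> fold apply_oper ops c = (d', C')"
      and uniq: "\<And>q. (case q of (c, ops) \<Rightarrow> c \<in> start_orbits \<and> fold apply_oper ops c = (d', C')) \<Longrightarrow> q = r"
      by (elim ex1E) blast
    obtain c0 ops0 where r_eq: "r = (c0, ops0)" by (cases r)
    show ?thesis
    proof (rule ex1I[of _ "(c0, ops0 @ [F])"])
      show "case (c0, ops0 @ [F]) of (c, ops) \<Rightarrow> c \<in> start_orbits \<and> fold apply_oper ops c = (d, C)"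
        using r r_eq 2 apply_oper_eq by simp
    next
      fix q assume q: "case q of (c, ops) \<Rightarrow> c \<in> start_orbits \<and> fold apply_oper ops c = (d, C)"
      obtain c ops where cq: "q = (c, ops)" by (cases q)
      have c: "c \<in> start_orbits" "fold apply_oper ops c = (d, C)" using q cq by auto
      show "q = (c0, ops0 @ [F])"
      proof (cases ops rule: rev_cases)
        case Nil
        then have "(d, C) \<in> start_orbits" using c by simp
        then show ?thesis using ext_orbit_not_start[OF 2(1,2)] 2 by metis
      next
        case (snoc ops' F')
        obtain d'' C'' where *: "d'' \<ge> 1" "C'' \<in> MIS_orbits d''" "fold apply_oper ops' c = (d'', C'')"
            "d = d'' + oper_incr F'" "C = ext_orbit F' d'' C''"
          using last[OF c(1)] c(2) snoc by blast
        have "F' = F \<and> d'' = d' \<and> C'' = C'"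
          by (rule ext_orbit_unique[OF *(1,2) 2(1,2)]) (use * 2 in auto)
        then have "(c, ops') = r" using uniq[of "(c, ops')"] c(1) * by simp
        then show ?thesis using cq snoc r_eq \<open>F' = F \<and> _\<close> by simp
      qed
    qed
  qed
qed

section \<open>Stabilizers are generated by disjoint transpositions\<close>

text \<open>
  A permutation stabilizing the new set respects its top block. It stabilizes the old set,
  possibly after exchanging the two digits of the block.
\<close>

lemma stab_oper_fun:
  assumes d: "d \<ge> 1" and S: "S \<in> MIS d"
  shows "stab (d + oper_incr F) (oper_fun F d S) = stab d S \<union>
    (if oper_incr F = 2 then (\<lambda>p. p \<circ> transpose d (d + 1)) ` stab d S else {})"
proof -
  let ?\<tau> = "transpose d (d + 1)" and ?D = "d + oper_incr F"
  have sub: "p \<in> stab ?D (oper_fun F d S)" if "p \<in> stab d S" for p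
    using that permutes_mono[of p d "oper_incr F"] oper_fun_act[OF d S, of p F] unfolding mem_stab by simp
  show ?thesis
  proof (intro equalityI subsetI)
    fix p assume "p \<in> stab ?D (oper_fun F d S)"
    then have p: "p permutes {..<?D}" "act p (oper_fun F d S) = oper_fun F d S" unfolding mem_stab by auto
    obtain q where "q permutes {..<d}" "act q S = S" "p = q \<or> oper_incr F = 2 \<and> p = q \<circ> ?\<tau>"
      using oper_fun_unique(3)[OF d S d S refl p] by blast
    then have "q \<in> stab d S" "p = q \<or> oper_incr F = 2 \<and> p = q \<circ> ?\<tau>" unfolding mem_stab by auto
    then show "p \<in> stab d S \<union> (if oper_incr F = 2 then (\<lambda>p. p \<circ> ?\<tau>) ` stab d S else {})"
      by auto
  next
    fix p assume p: "p \<in> stab d S \<union> (if oper_incr F = 2 then (\<lambda>p. p \<circ> ?\<tau>) ` stab d S else {})"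
    show "p \<in> stab ?D (oper_fun F d S)"
    proof (cases "p \<in> stab d S")
      case True then show ?thesis by (rule sub)
    next
      case False
      then obtain q where 2: "oper_incr F = 2" and q: "q \<in> stab d S" "p = q \<circ> ?\<tau>"
        using p by (auto split: if_splits)
      have \<tau>: "?\<tau> permutes {..<?D}" by (rule permutes_swap_id) (auto simp: 2)
      have q': "q permutes {..<?D}" "act q (oper_fun F d S) = oper_fun F d S"
        using sub[OF q(1)] unfolding mem_stab by blast+
      have "act (q \<circ> ?\<tau>) (oper_fun F d S) = oper_fun F d S"
        unfolding act_comp[symmetric] act_swap_oper_fun[OF d S 2] by (rule q'(2))
      then show ?thesis
        unfolding mem_stab q(2) using permutes_compose[OF \<tau> q'(1)] by blast
    qed
  qed
qed

lemma finite_stab: "finite (stab d S)"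
  by (rule finite_subset[OF _ finite_permutations[of "{..<d}"]]) (auto simp: mem_stab)

lemma card_stab_oper_fun:
  assumes d: "d \<ge> 1" and S: "S \<in> MIS d"
  shows "card (stab (d + oper_incr F) (oper_fun F d S)) = oper_incr F * card (stab d S)"
proof -
  let ?\<tau> = "transpose d (d + 1)"
  let ?A = "(\<lambda>p. p \<circ> ?\<tau>) ` stab d S"
  have "card ?A = card (stab d S)"
  proof (rule card_image, rule inj_onI)
    fix p q assume "p \<circ> ?\<tau> = q \<circ> ?\<tau>"
    then have "(p \<circ> ?\<tau>) \<circ> ?\<tau> = (q \<circ> ?\<tau>) \<circ> ?\<tau>" by simp
    then show "p = q" by (simp add: comp_assoc)
  qed
  moreover have "stab d S \<inter> ?A = {}"
  proof -
    have "p \<circ> ?\<tau> \<notin> stab d S" if "p \<in> stab d S" for p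
    proof
      assume "p \<circ> ?\<tau> \<in> stab d S"
      then have "(p \<circ> ?\<tau>) d = d" unfolding mem_stab using permutes_not_in[of "p \<circ> ?\<tau>" "{..<d}" d] by simp
      moreover have "p (d + 1) = d + 1" using that permutes_not_in[of p "{..<d}" "d + 1"] unfolding mem_stab by simp
      ultimately show False by simp
    qed
    then show ?thesis by blast
  qed
  ultimately have "card (stab d S \<union> ?A) = 2 * card (stab d S)"
    using finite_stab[of d S] by (simp add: card_Un_disjoint)
  moreover have "oper_incr F = 1 \<or> oper_incr F = 2" by (cases F) auto
  ultimately show ?thesis
    unfolding stab_oper_fun[OF d S] by (elim disjE) simp_all
qed

text \<open>
  The submonoid generated by \<open>T\<close>. Unlike the generated subgroup it does not refer to the ambient
  group, which grows with the number of digits.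
\<close>

inductive_set compositions :: "('a \<Rightarrow> 'a) set \<Rightarrow> ('a \<Rightarrow> 'a) set" for T where
  id: "id \<in> compositions T"
| comp: "p \<in> compositions T \<Longrightarrow> t \<in> T \<Longrightarrow> p \<circ> t \<in> compositions T"

lemma compositions_mono: "T \<subseteq> T' \<Longrightarrow> p \<in> compositions T \<Longrightarrow> p \<in> compositions T'"
  by (rotate_tac, induction rule: compositions.induct) (auto intro: compositions.intros)

lemma compositions_generate:
  assumes "p \<in> compositions T"
  shows "p \<in> generate (perm_group d) T"
  using assms
proof induction
  case id
  show ?case using generate.one[of "perm_group d" T] unfolding perm_group_simps .
next
  case (comp p t)
  show ?case using generate.eng[OF comp.IH generate.incl[OF comp.hyps(2)]] unfolding perm_group_simps .
qed

lemma compositions_conj: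
  assumes p: "p permutes A" and "q \<in> compositions T"
  shows "pinv p \<circ> q \<circ> p \<in> compositions ((\<lambda>t. pinv p \<circ> t \<circ> p) ` T)"
  using assms(2)
proof induction
  case id
  have "pinv p \<circ> id \<circ> p = id" by (simp add: permutes_inv_o[OF p])
  then show ?case using compositions.id by metis
next
  case (comp q t)
  have "(pinv p \<circ> q \<circ> p) \<circ> (pinv p \<circ> t \<circ> p) = pinv p \<circ> (q \<circ> t) \<circ> p"
    by (simp add: fun_eq_iff permutes_inverses[OF p])
  then show ?case using compositions.comp[OF comp.IH imageI[OF comp.hyps(2)]] by metis
qed

lemma conj_transpose:
  assumes p: "p permutes A"
  shows "pinv p \<circ> transpose i j \<circ> p = transpose (pinv p i) (pinv p j)"
proof
  fix x
  have "p x = i \<longleftrightarrow> x = pinv p i" "p x = j \<longleftrightarrow> x = pinv p j"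
    using permutes_inverses[OF p] by metis+
  then show "(pinv p \<circ> transpose i j \<circ> p) x = transpose (pinv p i) (pinv p j) x"
    by (simp add: transpose_def permutes_inverses[OF p])
qed

text \<open>
  A form of the statement on stabilizers that passes from \<open>d\<close> to more digits; transpositions are
  their own inverses, so the submonoid already is the subgroup.
\<close>

definition disjointly_generated :: "nat \<Rightarrow> node set \<Rightarrow> bool" where
  "disjointly_generated d S \<longleftrightarrow> (\<exists>T \<subseteq> transpositions d. pairwise disjoint_perms T \<and> T \<subseteq> stab d S
     \<and> stab d S \<subseteq> compositions T)"

text \<open>
  Conjugating by \<open>p\<close> turns generators for \<open>act p S\<close> into generators for \<open>S\<close> and keeps them
  disjoint transpositions.
\<close>

lemma disjointly_generated_conj:
  assumes p: "p permutes {..<d}" and "disjointly_generated d (act p S)"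
  shows "disjointly_generated d S"
proof -
  obtain T where T: "T \<subseteq> transpositions d" "pairwise disjoint_perms T" "T \<subseteq> stab d (act p S)"
    "stab d (act p S) \<subseteq> compositions T" using assms(2) unfolding disjointly_generated_def by blast
  let ?c = "\<lambda>t. pinv p \<circ> t \<circ> p"
  have pi: "pinv p permutes {..<d}" by (rule permutes_inv[OF p])
  have "?c ` T \<subseteq> transpositions d"
  proof (rule image_subsetI)
    fix t assume "t \<in> T"
    then obtain i j where ij: "t = transpose i j" "i < d" "j < d" "i \<noteq> j"
      using T(1) unfolding transpositions_def by blast
    have "pinv p i \<noteq> pinv p j" using ij(4) permutes_inverses(1)[OF p] by metis
    moreover have "pinv p i < d" "pinv p j < d" using ij by (simp_all add: permutes_inv_less[OF p])
    ultimately show "?c t \<in> transpositions d"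
      unfolding transpositions_def ij(1) conj_transpose[OF p] by blast
  qed
  moreover have "pairwise disjoint_perms (?c ` T)"
  proof -
    have m: "?c t x \<noteq> x \<longleftrightarrow> t (p x) \<noteq> p x" for t x
    proof -
      have "pinv p (t (p x)) = x \<longleftrightarrow> t (p x) = p x" using permutes_inverses[OF p] by metis
      then show ?thesis by simp
    qed
    have conj: "disjoint_perms (?c s) (?c t)" if "disjoint_perms s t" for s t
      using that unfolding disjoint_perms_def m disjoint_iff mem_Collect_eq by metis
    show ?thesis
      by (rule pairwise_imageI) (rule conj[OF pairwiseD[OF T(2)]])
  qed
  moreover have "?c ` T \<subseteq> stab d S"
  proof (rule image_subsetI)
    fix t assume "t \<in> T"
    then have "t \<in> stab d (act p S)" by (rule subsetD[OF T(3)])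
    then have t: "t permutes {..<d}" "act t (act p S) = act p S" unfolding mem_stab by simp_all
    have "act (?c t) S = S" unfolding act_comp[symmetric] t(2) by (rule act_inv(1)[OF p])
    then show "?c t \<in> stab d S"
      unfolding mem_stab using permutes_compose[OF p permutes_compose[OF t(1) pi]] by blast
  qed
  moreover have "stab d S \<subseteq> compositions (?c ` T)"
  proof
    fix q assume "q \<in> stab d S"
    then have q: "q permutes {..<d}" "act q S = S" unfolding mem_stab by auto
    have "p \<circ> q \<circ> pinv p \<in> stab d (act p S)"
    proof -
      have "act (p \<circ> q \<circ> pinv p) (act p S) = act p S"
        unfolding act_comp[symmetric] act_inv(1)[OF p] q(2) ..
      then show ?thesis
        unfolding mem_stab using permutes_compose[OF pi permutes_compose[OF q(1) p]] by blast
    qed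
    then have "p \<circ> q \<circ> pinv p \<in> compositions T" using T(4) by (rule subsetD[rotated])
    then have "?c (p \<circ> q \<circ> pinv p) \<in> compositions (?c ` T)"
      by (rule compositions_conj[OF p])
    moreover have "?c (p \<circ> q \<circ> pinv p) = q"
      by (simp add: fun_eq_iff permutes_inverses[OF p])
    ultimately show "q \<in> compositions (?c ` T)" by metis
  qed
  ultimately show ?thesis unfolding disjointly_generated_def by blast
qed

lemma disjointly_generated_oper_fun:
  assumes d: "d \<ge> 1" and S: "S \<in> MIS d" and G: "disjointly_generated d S"
  shows "disjointly_generated (d + oper_incr F) (oper_fun F d S)"
proof -
  let ?\<tau> = "transpose d (d + 1)"
  obtain T where T: "T \<subseteq> transpositions d" "pairwise disjoint_perms T" "T \<subseteq> stab d S"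
    "stab d S \<subseteq> compositions T" using G unfolding disjointly_generated_def by blast
  have mono: "transpositions d \<subseteq> transpositions (d + oper_incr F)"
    unfolding transpositions_def by fastforce
  consider "oper_incr F = 1" | "oper_incr F = 2" by (cases F) auto
  then show ?thesis
  proof cases
    case 1
    then have st: "stab (d + oper_incr F) (oper_fun F d S) = stab d S" unfolding stab_oper_fun[OF d S] by simp
    show ?thesis unfolding disjointly_generated_def st
      by (intro exI[of _ T] conjI) (use T mono in auto)
  next
    case 2
    have st: "stab (d + oper_incr F) (oper_fun F d S) = stab d S \<union> (\<lambda>p. p \<circ> ?\<tau>) ` stab d S"
      unfolding stab_oper_fun[OF d S] using 2 by simp
    have disj: "disjoint_perms t ?\<tau> \<and> disjoint_perms ?\<tau> t" if "t \<in> T" for t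
    proof -
      have "t \<in> stab d S" using that T(3) by (rule subsetD[rotated])
      then have t: "t permutes {..<d}" unfolding mem_stab by simp
      have "t x = x \<or> ?\<tau> x = x" for x
      proof (cases "x < d")
        case True
        then show ?thesis by (simp add: transpose_def)
      next
        case False
        then show ?thesis using permutes_not_in[OF t] by simp
      qed
      then show ?thesis unfolding disjoint_perms_def disjoint_iff mem_Collect_eq by metis
    qed
    have "insert ?\<tau> T \<subseteq> transpositions (d + oper_incr F)"
    proof -
      have "d < d + oper_incr F \<and> d + 1 < d + oper_incr F \<and> d \<noteq> d + 1" using 2 by simp
      then have "?\<tau> \<in> transpositions (d + oper_incr F)" unfolding transpositions_def by blast
      then show ?thesis using subset_trans[OF T(1) mono] by simp
    qed
    moreover have "pairwise disjoint_perms (insert ?\<tau> T)"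
      unfolding pairwise_insert using T(2) disj by metis
    moreover have "insert ?\<tau> T \<subseteq> stab d S \<union> (\<lambda>p. p \<circ> ?\<tau>) ` stab d S"
    proof -
      have "id \<in> stab d S" unfolding mem_stab by (simp add: act_id permutes_id)
      then have "id \<circ> ?\<tau> \<in> (\<lambda>p. p \<circ> ?\<tau>) ` stab d S" by (rule imageI)
      then show ?thesis using T(3) by auto
    qed
    moreover have "stab d S \<union> (\<lambda>p. p \<circ> ?\<tau>) ` stab d S \<subseteq> compositions (insert ?\<tau> T)"
    proof -
      have "p \<in> compositions (insert ?\<tau> T)" if "p \<in> stab d S" for p
        using that T(4) compositions_mono[of T "insert ?\<tau> T" p] by blast
      then show ?thesis using compositions.comp[of _ "insert ?\<tau> T" ?\<tau>] by blast
    qed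
    ultimately show ?thesis unfolding disjointly_generated_def st by blast
  qed
qed

theorem stab_structure:
  assumes "d \<ge> 1" "S \<in> MIS d"
  shows "disjointly_generated d S \<and> (\<exists>k. card (stab d S) = 2 ^ k)"
  using assms
proof (induction d arbitrary: S rule: less_induct)
  case (less d S)
  show ?case
  proof (cases "nonloops d S = {}")
    case True
    have "stab d S = {id}" by (rule no_nonloops_start(2)[OF less.prems True])
    moreover from this have "disjointly_generated d S"
      unfolding disjointly_generated_def using compositions.id
      by (intro exI[of _ "{}"]) simp
    moreover have "card {id :: nat \<Rightarrow> nat} = 2 ^ 0" by simp
    ultimately show ?thesis by metis
  next
    case False
    obtain F d' S' p where *: "d' \<ge> 1" "S' \<in> MIS d'" "d = d' + oper_incr F" "p permutes {..<d}"
      "act p S = oper_fun F d' S'" using MIS_decompose[OF less.prems False] .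
    have "d' < d" using * by (cases F) auto
    note IH = less.IH[OF this *(1,2)]
    have "disjointly_generated d (act p S)"
      unfolding *(5) *(3) using disjointly_generated_oper_fun *(1,2) IH by blast
    then have 1: "disjointly_generated d S" by (rule disjointly_generated_conj[OF *(4)])
    have "act p S \<in> orb d S" using *(4) unfolding mem_orb by blast
    then have "card (stab d S) = card (stab d (act p S))"
      using card_stab_orb[OF less.prems] by simp
    also have "\<dots> = oper_incr F * card (stab d' S')"
      unfolding *(5) *(3) by (rule card_stab_oper_fun[OF *(1,2)])
    finally have c: "card (stab d S) = oper_incr F * card (stab d' S')" .
    obtain k where "card (stab d' S') = 2 ^ k" using IH by blast
    then have "card (stab d S) = 2 ^ k \<or> card (stab d S) = 2 ^ Suc k" using c by (cases F) auto
    then show ?thesis using 1 by blast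
  qed
qed

lemma disjointly_generatedD:
  assumes d: "d \<ge> 1" and S: "S \<in> MIS d" and "disjointly_generated d S"
  shows "\<exists>T \<subseteq> transpositions d. pairwise disjoint_perms T \<and> stab d S = generate (perm_group d) T"
proof -
  obtain T where T: "T \<subseteq> transpositions d" "pairwise disjoint_perms T" "T \<subseteq> stab d S"
    "stab d S \<subseteq> compositions T" using assms(3) unfolding disjointly_generated_def by blast
  have "generate (perm_group d) T \<subseteq> stab d S"
    by (rule group.generate_subgroup_incl[OF perm_group_is_group T(3) stab_subgroup[OF d S]])
  then have "stab d S = generate (perm_group d) T"
    using T(4) compositions_generate by blast
  then show ?thesis using T by blast
qed

section \<open>Summing over orbits\<close>

lemma finite_MIS_orbits: "finite (MIS_orbits d)"
proof -
  have "MIS d \<subseteq> Pow (nodes d)" unfolding MIS_def using indep_subset by blast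
  then have "finite (MIS d)" using finite_nodes finite_subset by (metis finite_Pow_iff)
  moreover have "MIS_orbits d = orb d ` MIS d" using mem_MIS_orbits by blast
  ultimately show ?thesis by simp
qed

text \<open>
  The common size of the stabilizers of the elements of an orbit.
\<close>

definition stab_size :: "nat \<Rightarrow> node set set \<Rightarrow> nat" where
  "stab_size d C = card (stab d (SOME S. S \<in> C))"

lemma stab_size_eq:
  assumes d: "d \<ge> 1" and C: "C \<in> MIS_orbits d" and S: "S \<in> C"
  shows "stab_size d C = card (stab d S)"
proof -
  obtain S0 where S0: "S0 \<in> MIS d" "C = orb d S0" using C mem_MIS_orbits by blast
  have "(SOME S. S \<in> C) \<in> C" using S by (rule someI)
  then show ?thesis
    unfolding stab_size_def using card_stab_orb[OF d S0(1)] S S0(2) by metis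
qed

lemma MIS_orbits_nonempty: "C \<in> MIS_orbits d \<Longrightarrow> \<exists>S. S \<in> C \<and> S \<in> MIS d \<and> C = orb d S"
  unfolding mem_MIS_orbits using orb_refl by blast

lemma stab_size_iff:
  assumes d: "d \<ge> 1" and C: "C \<in> MIS_orbits d"
  shows "(\<forall>S\<in>C. card (stab d S) = m) \<longleftrightarrow> stab_size d C = m"
  using stab_size_eq[OF assms] MIS_orbits_nonempty[OF C] by metis

lemma stab_size_start:
  assumes "(d, C) \<in> start_orbits"
  shows "stab_size d C = 1"
proof -
  note s = start_orbit_MIS[OF assms]
  obtain S where S: "S \<in> C" "S \<in> MIS d" using MIS_orbits_nonempty[OF s(2)] by blast
  then show ?thesis
    using stab_size_eq[OF s(1,2) S(1)] no_nonloops_start(2)[OF s(1) S(2) s(3)[OF S(1)]] by simp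
qed

lemma stab_size_ext:
  assumes d: "d \<ge> 1" and C: "C \<in> MIS_orbits d"
  shows "stab_size (d + oper_incr F) (ext_orbit F d C) = oper_incr F * stab_size d C"
proof -
  obtain S where S: "S \<in> C" "S \<in> MIS d" "C = orb d S" using MIS_orbits_nonempty[OF C] by blast
  have "oper_fun F d S \<in> ext_orbit F d C"
    unfolding S(3) ext_orbit_orb[OF d S(2)] by (rule orb_refl)
  then have "stab_size (d + oper_incr F) (ext_orbit F d C) = card (stab (d + oper_incr F) (oper_fun F d S))"
    using stab_size_eq[OF _ ext_orbit_in_MIS_orbits[OF d C]] d by simp
  also have "\<dots> = oper_incr F * stab_size d C"
    using card_stab_oper_fun[OF d S(2)] stab_size_eq[OF d C S(1)] by simp
  finally show ?thesis .
qed

text \<open>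
  All enumerations are sums over orbits of a weight depending on the size of the stabilizer: the
  indicator function of \<open>2\<^sup>k\<close> counts the orbits with stabilizers of size \<open>2\<^sup>k\<close>, and
  the reciprocal gives the number of MISs divided by \<open>d!\<close>. So one recurrence serves both.
\<close>

definition orbit_sum :: "nat \<Rightarrow> (nat \<Rightarrow> 'b :: comm_monoid_add) \<Rightarrow> 'b" where
  "orbit_sum d \<phi> = (\<Sum>C\<in>MIS_orbits d. \<phi> (stab_size d C))"

lemma MIS_orbits_rec:
  assumes d: "d \<ge> 1"
  shows "MIS_orbits d = {C. (d, C) \<in> start_orbits} \<union>
    (\<Union>F\<in>{F. oper_incr F < d}. ext_orbit F (d - oper_incr F) ` MIS_orbits (d - oper_incr F))"
proof (intro equalityI subsetI)
  fix C assume "C \<in> MIS_orbits d"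
  from MIS_orbits_cases[OF d this]
  show "C \<in> {C. (d, C) \<in> start_orbits} \<union>
    (\<Union>F\<in>{F. oper_incr F < d}. ext_orbit F (d - oper_incr F) ` MIS_orbits (d - oper_incr F))"
  proof cases
    case 1 then show ?thesis by simp
  next
    case (2 F d' C')
    then have "oper_incr F < d" "d' = d - oper_incr F" by auto
    then show ?thesis using 2 by blast
  qed
next
  fix C assume "C \<in> {C. (d, C) \<in> start_orbits} \<union>
    (\<Union>F\<in>{F. oper_incr F < d}. ext_orbit F (d - oper_incr F) ` MIS_orbits (d - oper_incr F))"
  then consider "(d, C) \<in> start_orbits"
    | F C' where "oper_incr F < d" "C' \<in> MIS_orbits (d - oper_incr F)" "C = ext_orbit F (d - oper_incr F) C'"
    by blast
  then show "C \<in> MIS_orbits d"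
  proof cases
    case 1 then show ?thesis by (rule start_orbit_MIS(2))
  next
    case 2
    then show ?thesis using ext_orbit_in_MIS_orbits[of "d - oper_incr F" C' F] by simp
  qed
qed

lemma UNIV_oper: "UNIV = {Op_f, Op_f', Op_g, Op_g'}"
  using oper.exhaust by blast

text \<open>
  Starting orbits have trivial stabilizers; applying \<open>F\<close> multiplies the size of the stabilizers by
  the number of new digits.
\<close>

lemma orbit_sum_rec:
  assumes d: "d \<ge> 1"
  shows "orbit_sum d \<phi> = (if d \<le> 2 then \<phi> 1 else 0)
     + (\<Sum>F\<in>{F. oper_incr F < d}. orbit_sum (d - oper_incr F) (\<lambda>m. \<phi> (oper_incr F * m)))"
proof -
  let ?A = "{C. (d, C) \<in> start_orbits}" and ?I = "{F. oper_incr F < d}"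
  let ?B = "\<lambda>F. ext_orbit F (d - oper_incr F) ` MIS_orbits (d - oper_incr F)"
  let ?w = "\<lambda>C. \<phi> (stab_size d C)"
  have fI: "finite ?I" by (rule finite_subset[OF subset_UNIV]) (simp add: UNIV_oper)
  have A: "?A = (if d = 1 then {orb 1 (start_set 1)} else if d = 2 then {orb 2 (start_set 2)} else {})"
    unfolding start_orbits_alt by auto
  have fA: "finite ?A" unfolding A by simp
  have cA: "card ?A = (if d \<le> 2 then 1 else 0)" unfolding A using d by auto
  have uniq: "F = F' \<and> C = C'" if "F \<in> ?I" "F' \<in> ?I" "C \<in> MIS_orbits (d - oper_incr F)" "C' \<in> MIS_orbits (d - oper_incr F')"
     "ext_orbit F (d - oper_incr F) C = ext_orbit F' (d - oper_incr F') C'" for F F' C C'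
    using ext_orbit_unique[OF _ that(3) _ that(4) _ that(5)] that(1,2) by simp
  have disj: "?A \<inter> (\<Union>F\<in>?I. ?B F) = {}"
  proof -
    have "(d, ext_orbit F (d - oper_incr F) C) \<notin> start_orbits"
      if "oper_incr F < d" "C \<in> MIS_orbits (d - oper_incr F)" for F C
      using ext_orbit_not_start[OF _ that(2), of F] that(1) by simp
    then show ?thesis by blast
  qed
  have "orbit_sum d \<phi> = sum ?w ?A + sum ?w (\<Union>F\<in>?I. ?B F)"
    unfolding orbit_sum_def MIS_orbits_rec[OF d]
    by (rule sum.union_disjoint[OF fA _ disj]) (use fI finite_MIS_orbits in auto)
  also have "sum ?w ?A = (\<Sum>C\<in>?A. \<phi> 1)"
    using stab_size_start by (intro sum.cong) auto
  also have "\<dots> = (if d \<le> 2 then \<phi> 1 else 0)" unfolding A using d by auto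
  also have "sum ?w (\<Union>F\<in>?I. ?B F) = (\<Sum>F\<in>?I. sum ?w (?B F))"
  proof (rule sum.UNION_disjoint[OF fI])
    show "\<forall>F\<in>?I. finite (?B F)" using finite_MIS_orbits by blast
    show "\<forall>F\<in>?I. \<forall>F'\<in>?I. F \<noteq> F' \<longrightarrow> ?B F \<inter> ?B F' = {}" using uniq by blast
  qed
  also have "\<dots> = (\<Sum>F\<in>?I. orbit_sum (d - oper_incr F) (\<lambda>m. \<phi> (oper_incr F * m)))"
  proof (rule sum.cong[OF refl])
    fix F assume F: "F \<in> ?I"
    have "inj_on (ext_orbit F (d - oper_incr F)) (MIS_orbits (d - oper_incr F))"
      by (rule inj_onI) (use uniq[OF F F] in blast)
    then have "sum ?w (?B F) = (\<Sum>C\<in>MIS_orbits (d - oper_incr F). ?w (ext_orbit F (d - oper_incr F) C))"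
      by (simp add: sum.reindex)
    also have "\<dots> = orbit_sum (d - oper_incr F) (\<lambda>m. \<phi> (oper_incr F * m))"
      unfolding orbit_sum_def
    proof (rule sum.cong[OF refl])
      fix C assume "C \<in> MIS_orbits (d - oper_incr F)"
      then show "?w (ext_orbit F (d - oper_incr F) C) = \<phi> (oper_incr F * stab_size (d - oper_incr F) C)"
        using stab_size_ext[of "d - oper_incr F" C F] F by simp
    qed
    finally show "sum ?w (?B F) = orbit_sum (d - oper_incr F) (\<lambda>m. \<phi> (oper_incr F * m))" .
  qed
  finally show ?thesis .
qed

lemma orbit_sum_1: "orbit_sum 1 \<phi> = \<phi> 1"
proof -
  have "{F. oper_incr F < 1} = {}"
  proof -
    have "\<not> oper_incr F < 1" for F by (cases F) auto
    then show ?thesis by blast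
  qed
  then show ?thesis using orbit_sum_rec[of 1 \<phi>] by (simp only: sum.empty) simp
qed

lemma orbit_sum_2: "orbit_sum 2 \<phi> = \<phi> 1 + \<phi> 1 + \<phi> 1"
proof -
  have "oper_incr F < 2 \<longleftrightarrow> F = Op_f \<or> F = Op_f'" for F by (cases F) auto
  then have "{F. oper_incr F < 2} = {Op_f, Op_f'}" by blast
  then show ?thesis using orbit_sum_rec[of 2 \<phi>] orbit_sum_1[of \<phi>] by (simp add: add.assoc)
qed

lemma orbit_sum_ge_3:
  assumes "d \<ge> 3"
  shows "orbit_sum d \<phi> = (orbit_sum (d - 1) \<phi> + orbit_sum (d - 1) \<phi>)
     + (orbit_sum (d - 2) (\<lambda>m. \<phi> (2 * m)) + orbit_sum (d - 2) (\<lambda>m. \<phi> (2 * m)))"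
proof -
  have "oper_incr F < d" for F using assms by (cases F) auto
  then have "{F. oper_incr F < d} = {Op_f, Op_f', Op_g, Op_g'}" using UNIV_oper by auto
  then show ?thesis using orbit_sum_rec[of d \<phi>] assms by (simp add: add.assoc)
qed

lemma num_orbits_sum:
  assumes "d \<ge> 1" "k \<ge> 0"
  shows "num_orbits d k = orbit_sum d (\<lambda>m. if m = 2 ^ nat k then 1 else 0)"
proof -
  have "{C \<in> MIS_orbits d. \<forall>S\<in>C. card (stab d S) = 2 ^ nat k} = {C \<in> MIS_orbits d. stab_size d C = 2 ^ nat k}"
    using stab_size_iff[OF assms(1)] by blast
  then show ?thesis
    unfolding num_orbits_def orbit_sum_def using assms(2) finite_MIS_orbits[of d]
    by (simp add: sum.If_cases Int_def)
qed

lemma num_orbits_1: "num_orbits 1 k = (if k = 0 then 1 else 0)"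
proof (cases "k < 0")
  case False
  then have "num_orbits 1 k = (if 1 = (2 :: nat) ^ nat k then 1 else 0)"
    using num_orbits_sum[of 1 k] unfolding orbit_sum_1 by simp
  then show ?thesis using False by (cases "nat k") auto
qed (simp add: num_orbits_def)

lemma num_orbits_2: "num_orbits 2 k = (if k = 0 then 3 else 0)"
proof (cases "k < 0")
  case False
  then have "num_orbits 2 k = (if 1 = (2 :: nat) ^ nat k then 3 else 0)"
    using num_orbits_sum[of 2 k] unfolding orbit_sum_2 by simp
  then show ?thesis using False by (cases "nat k") auto
qed (simp add: num_orbits_def)

lemma num_orbits_rec:
  assumes d: "d \<ge> 3" and k: "k \<ge> 0"
  shows "num_orbits d k = 2 * num_orbits (d - 1) k + 2 * num_orbits (d - 2) (k - 1)"
proof -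
  let ?\<phi> = "\<lambda>m :: nat. if m = 2 ^ nat k then 1 else 0 :: nat"
  have "orbit_sum (d - 2) (\<lambda>m. ?\<phi> (2 * m)) = num_orbits (d - 2) (k - 1)"
  proof (cases "k = 0")
    case True
    then have "?\<phi> (2 * m) = 0" for m by simp
    then show ?thesis using True unfolding orbit_sum_def num_orbits_def by simp
  next
    case False
    then have "nat k = Suc (nat (k - 1))" using k by simp
    then have "2 * m = 2 ^ nat k \<longleftrightarrow> m = 2 ^ nat (k - 1)" for m :: nat by simp
    then show ?thesis using num_orbits_sum[of "d - 2" "k - 1"] d k False by simp
  qed
  moreover have "orbit_sum (d - 1) ?\<phi> = num_orbits (d - 1) k" "orbit_sum d ?\<phi> = num_orbits d k"
    using num_orbits_sum[of d k] num_orbits_sum[of "d - 1" k] d k by simp_all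
  ultimately show ?thesis
    using orbit_sum_ge_3[OF d, of ?\<phi>] by presburger
qed

text \<open>
  By the orbit-stabilizer theorem an orbit has \<open>d!\<close> divided by \<open>stab_size\<close> elements.
\<close>

lemma num_MIS_sum:
  assumes d: "d \<ge> 1"
  shows "of_nat (num_MIS d) = (fact d :: rat) * orbit_sum d (\<lambda>m. 1 / of_nat m)"
proof -
  have MU: "MIS d = \<Union> (MIS_orbits d)"
  proof -
    have "S \<in> MIS d \<Longrightarrow> S \<in> orb d S \<and> orb d S \<in> MIS_orbits d" for S
      unfolding mem_MIS_orbits using orb_refl by blast
    moreover have "S \<in> MIS d" if "S \<in> C" "C \<in> MIS_orbits d" for S C
      using that orb_MIS[OF d] unfolding mem_MIS_orbits by blast
    ultimately show ?thesis by blast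
  qed
  have "pairwise disjnt (MIS_orbits d)"
  proof (rule pairwiseI)
    fix C C' assume C: "C \<in> MIS_orbits d" "C' \<in> MIS_orbits d" "C \<noteq> C'"
    then obtain S S' where S: "C = orb d S" "C' = orb d S'" unfolding mem_MIS_orbits by blast
    have "C = C'" if "T \<in> C" "T \<in> C'" for T
      using orb_eq[of T d S] orb_eq[of T d S'] that unfolding S by simp
    then show "disjnt C C'" using C(3) unfolding disjnt_def by blast
  qed
  moreover have "finite C" if "C \<in> MIS_orbits d" for C
  proof -
    have "C \<subseteq> Pow (nodes d)" using that MU unfolding MIS_def using indep_subset by blast
    then show ?thesis using finite_nodes finite_subset by (metis finite_Pow_iff)
  qed
  ultimately have "card (MIS d) = (\<Sum>C\<in>MIS_orbits d. card C)"
    unfolding MU by (rule card_Union_disjoint)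
  then have "(of_nat (num_MIS d) :: rat) = (\<Sum>C\<in>MIS_orbits d. of_nat (card C))"
    unfolding num_MIS_def by simp
  also have "\<dots> = (\<Sum>C\<in>MIS_orbits d. fact d * (1 / of_nat (stab_size d C)))"
  proof (rule sum.cong[OF refl])
    fix C assume C: "C \<in> MIS_orbits d"
    obtain S where S: "S \<in> C" "S \<in> MIS d" "C = orb d S" using MIS_orbits_nonempty[OF C] by blast
    have "card C * stab_size d C = fact d"
      using orbit_stabilizer[OF d S(2)] stab_size_eq[OF d C S(1)] S(3) by simp
    then have "(of_nat (card C) * of_nat (stab_size d C) :: rat) = fact d"
      by (metis of_nat_mult of_nat_fact)
    moreover from this have "(of_nat (stab_size d C) :: rat) \<noteq> 0" using fact_nonzero[of d] by (metis mult_zero_right)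
    ultimately show "(of_nat (card C) :: rat) = fact d * (1 / of_nat (stab_size d C))"
      by (simp add: field_simps)
  qed
  finally show ?thesis by (simp add: orbit_sum_def sum_distrib_left)
qed

text \<open>
  The number of MISs divided by \<open>d!\<close>, that is, the number of orbits weighted by the reciprocals of
  their stabilizer sizes.
\<close>

definition mass :: "nat \<Rightarrow> rat" where
  "mass d = orbit_sum d (\<lambda>m. 1 / of_nat m)"

lemma mass_rec:
  assumes "d \<ge> 3"
  shows "mass d = 2 * mass (d - 1) + mass (d - 2)"
proof -
  have "orbit_sum (d - 2) (\<lambda>m. 1 / of_nat (2 * m) :: rat) = mass (d - 2) / 2"
    unfolding mass_def orbit_sum_def by (simp add: sum_divide_distrib field_simps)
  then show ?thesis using orbit_sum_ge_3[OF assms, of "\<lambda>m. 1 / of_nat m :: rat"] unfolding mass_def by simp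
qed

lemma num_MIS_mass: "d \<ge> 1 \<Longrightarrow> of_nat (num_MIS d) = fact d * mass d"
  unfolding mass_def by (rule num_MIS_sum)

lemma mass_1_2: "mass 1 = 1" "mass 2 = 3"
  unfolding mass_def orbit_sum_1 orbit_sum_2 by simp_all

lemma num_MIS_1: "num_MIS 1 = 1"
proof -
  have "(of_nat (num_MIS 1) :: rat) = of_nat 1" using num_MIS_mass[of 1] by (simp add: mass_1_2[simplified])
  then show ?thesis by (simp only: of_nat_eq_iff)
qed

lemma num_MIS_2: "num_MIS 2 = 6"
proof -
  have "(of_nat (num_MIS 2) :: rat) = of_nat 6" using num_MIS_mass[of 2] by (simp add: mass_1_2)
  then show ?thesis by (simp only: of_nat_eq_iff)
qed

lemma num_MIS_rec:
  assumes d: "d \<ge> 3"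
  shows "num_MIS d = 2 * d * num_MIS (d - 1) + d * (d - 1) * num_MIS (d - 2)"
proof -
  obtain n where n: "d = Suc (Suc n)" "n \<ge> 1" using d by (metis Suc_le_D Suc_le_mono numeral_3_eq_3 One_nat_def)
  have "(of_nat (num_MIS d) :: rat) = fact d * (2 * mass (d - 1) + mass (d - 2))"
    using num_MIS_mass[of d] mass_rec[OF d] d by simp
  also have "\<dots> = of_nat (2 * d * num_MIS (d - 1) + d * (d - 1) * num_MIS (d - 2))"
    using num_MIS_mass[of "Suc n"] num_MIS_mass[of n] n by (simp add: algebra_simps)
  finally show ?thesis by (simp only: of_nat_eq_iff)
qed

section \<open>Generating functions\<close>

unbundle fps_syntax

text \<open>
  The coefficients need not form a field: for the bivariate series they are power series in \<open>s\<close>,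
  and the denominator has constant term \<open>1\<close>.
\<close>

lemma fps_eq_divide:
  fixes G P Q :: "'a :: {comm_ring_1, inverse} fps"
  assumes "G * Q = P" "Q $ 0 = 1" "inverse (1 :: 'a) = 1"
  shows "G = P / Q"
proof -
  have "Q * inverse Q = 1"
    unfolding fps_inverse_def by (rule fps_right_inverse) (simp add: assms)
  then have "G = G * Q * inverse Q" by (simp add: mult.assoc)
  moreover have "P / Q = P * inverse Q" by (rule fps_divide_unit) (simp add: assms)
  ultimately show ?thesis using assms(1) by simp
qed

text \<open>
  At \<open>n = 1\<close> and \<open>n = 2\<close> the sequence exceeds what the recurrence would give by one, which is the
  contribution of a starting orbit; this excess is the numerator.
\<close>

lemma fps_two_term_recurrence:
  fixes G :: "'a :: comm_ring_1 fps"
  assumes "G $ 0 = 0" "G $ 1 = 1" "G $ 2 = 3"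
    and rec: "\<And>n. n \<ge> 3 \<Longrightarrow> G $ n = 2 * G $ (n - 1) + c * G $ (n - 2)"
  shows "G * (1 - 2 * fps_X - fps_const c * fps_X ^ 2) = fps_X + fps_X ^ 2"
proof (rule fps_ext)
  fix n :: nat
  have eq: "G * (1 - 2 * fps_X - fps_const c * fps_X ^ 2) = G - fps_const 2 * (fps_X * G) - fps_const c * (fps_X ^ 2 * G)"
    by (simp add: algebra_simps numeral_fps_const)
  consider "n = 0" | "n = 1" | "n = 2" | "n \<ge> 3" by linarith
  then show "(G * (1 - 2 * fps_X - fps_const c * fps_X ^ 2)) $ n = (fps_X + fps_X ^ 2) $ n"
    unfolding eq using assms(1-3) rec[of n]
    by cases (simp_all add: fps_X_power_mult_nth fps_X_nth fps_X_power_nth)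
qed

lemma orbit_gf_eq: "orbit_gf = (var_t + var_t ^ 2) / (1 - 2 * var_t - 2 * var_t ^ 2 * var_s)"
proof (rule fps_eq_divide)
  let ?c = "2 * fps_X :: rat fps"
  have g: "orbit_gf $ d $ k = of_nat (num_orbits d (int k))" if "d \<ge> 1" for d k
    unfolding orbit_gf_def using that by simp
  have rec: "orbit_gf * (1 - 2 * fps_X - fps_const ?c * fps_X ^ 2) = fps_X + fps_X ^ 2"
  proof (rule fps_two_term_recurrence)
    show "orbit_gf $ 0 = 0" by (simp add: orbit_gf_def)
    show "orbit_gf $ 1 = 1" by (rule fps_ext) (simp add: g num_orbits_1[simplified])
    show "orbit_gf $ 2 = 3" by (rule fps_ext) (simp add: g num_orbits_2 numeral_fps_const)
    fix d :: nat assume d: "d \<ge> 3"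
    show "orbit_gf $ d = 2 * orbit_gf $ (d - 1) + ?c * orbit_gf $ (d - 2)"
    proof (rule fps_ext)
      fix k
      have c: "?c * A = fps_const 2 * (fps_X * A)" "2 * A = fps_const 2 * A" for A :: "rat fps"
        by (simp_all add: numeral_fps_const mult.assoc)
      have "(?c * orbit_gf $ (d - 2)) $ k = 2 * of_nat (num_orbits (d - 2) (int k - 1))"
        unfolding c(1) using d g[of "d - 2" "k - 1"] by (cases k) (simp_all add: num_orbits_def)
      moreover have "(2 * orbit_gf $ (d - 1)) $ k = 2 * of_nat (num_orbits (d - 1) (int k))"
        unfolding c(2) using d g[of "d - 1" k] by simp
      ultimately show "orbit_gf $ d $ k = (2 * orbit_gf $ (d - 1) + ?c * orbit_gf $ (d - 2)) $ k"
        using g[of d k] num_orbits_rec[OF d, of "int k"] d by simp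
    qed
  qed
  have c: "2 * var_t ^ 2 * var_s = fps_const ?c * fps_X ^ 2"
    unfolding var_t_def var_s_def by (simp add: numeral_fps_const mult.commute mult.left_commute)
  show "orbit_gf * (1 - 2 * var_t - 2 * var_t ^ 2 * var_s) = var_t + var_t ^ 2"
    unfolding c unfolding var_t_def by (rule rec)
  show "(1 - 2 * var_t - 2 * var_t ^ 2 * var_s) $ 0 = 1"
    unfolding var_t_def by (simp add: fps_mult_nth_0)
  show "inverse (1 :: rat fps) = 1" by simp
qed

lemma MIS_egf_eq: "MIS_egf = (fps_X + fps_X ^ 2) / (1 - 2 * fps_X - fps_X ^ 2)"
proof (rule fps_eq_divide)
  have g: "MIS_egf $ d = (if d = 0 then 0 else mass d)" for d
    unfolding MIS_egf_def using num_MIS_mass[of d] by simp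
  have "MIS_egf * (1 - 2 * fps_X - fps_const 1 * fps_X ^ 2) = fps_X + fps_X ^ 2"
    by (rule fps_two_term_recurrence) (simp_all add: g mass_1_2[simplified] mass_rec)
  then show "MIS_egf * (1 - 2 * fps_X - fps_X ^ 2) = fps_X + fps_X ^ 2" by simp
qed simp_all

theorem theorem4p5:
  shows
    "(\<forall>d\<ge>1. \<forall>C \<in> MIS_orbits d.
        \<exists>!p. case p of (c, ops) \<Rightarrow> c \<in> start_orbits \<and> fold apply_oper ops c = (d, C))
   \<and> (\<forall>d\<ge>1. \<forall>S \<in> MIS d.
        (\<exists>T \<subseteq> transpositions d. pairwise disjoint_perms T \<and> stab d S = generate (perm_group d) T)
        \<and> (\<exists>k. card (stab d S) = 2 ^ k))
   \<and> (num_orbits 1 0 = 1 \<and> num_orbits 2 0 = 3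
      \<and> (\<forall>d\<ge>3. \<forall>k\<ge>0. num_orbits d k = 2 * num_orbits (d - 1) k + 2 * num_orbits (d - 2) (k - 1))
      \<and> orbit_gf = (var_t + var_t ^ 2) / (1 - 2 * var_t - 2 * var_t ^ 2 * var_s))
   \<and> (num_MIS 1 = 1 \<and> num_MIS 2 = 6
      \<and> (\<forall>d\<ge>3. num_MIS d = 2 * d * num_MIS (d - 1) + d * (d - 1) * num_MIS (d - 2))
      \<and> MIS_egf = (fps_X + fps_X ^ 2) / (1 - 2 * fps_X - fps_X ^ 2))"
proof (intro conjI allI impI ballI)
  fix d :: nat and C assume "1 \<le> d" "C \<in> MIS_orbits d"
  then show "\<exists>!p. case p of (c, ops) \<Rightarrow> c \<in> start_orbits \<and> fold apply_oper ops c = (d, C)"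
    by (rule unique_operator_word)
next
  fix d :: nat and S assume S: "1 \<le> d" "S \<in> MIS d"
  show "\<exists>T \<subseteq> transpositions d. pairwise disjoint_perms T \<and> stab d S = generate (perm_group d) T"
    using disjointly_generatedD[OF S] stab_structure[OF S] by blast
  show "\<exists>k. card (stab d S) = 2 ^ k"
    using stab_structure[OF S] by blast
next
  show "num_orbits 1 0 = 1" "num_orbits 2 0 = 3"
    by (simp_all only: num_orbits_1 num_orbits_2 if_True refl)
next
  fix d :: nat and k :: int assume "3 \<le> d" "0 \<le> k"
  then show "num_orbits d k = 2 * num_orbits (d - 1) k + 2 * num_orbits (d - 2) (k - 1)"
    by (rule num_orbits_rec)
next
  show "orbit_gf = (var_t + var_t ^ 2) / (1 - 2 * var_t - 2 * var_t ^ 2 * var_s)"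
    by (rule orbit_gf_eq)
next
  show "num_MIS 1 = 1" by (rule num_MIS_1)
  show "num_MIS 2 = 6" by (rule num_MIS_2)
next
  fix d :: nat assume "3 \<le> d"
  then show "num_MIS d = 2 * d * num_MIS (d - 1) + d * (d - 1) * num_MIS (d - 2)"
    by (rule num_MIS_rec)
next
  show "MIS_egf = (fps_X + fps_X ^ 2) / (1 - 2 * fps_X - fps_X ^ 2)"
    by (rule MIS_egf_eq)
qed

end
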